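(* In the setting described in the context, assume that $\{(X_j,Y_j)\}_{j\in\mathbb Z}$ is a stationary, $\beta$-mixing time series with $\alpha$-mixing coefficients $\alpha(j)=\mathcal O(j^{-\eta})$ for some $\eta>2$ and $\beta$-mixing coefficients $\beta(j)=\mathcal O(j^{-\nu})$ for some $\nu>0$, and that $F^x$ is continuous. Assume moreover: (C1) $u\mapsto 1/\gamma(u)$ is Lipschitz continuous on $U$ with constant $c_\gamma$; (C3) there exist $y_0>1$ and $c_L>0$ such that $\sup_{y\ge y_0}\left|\frac{\log L^{v}(y)-\log L^{u}(y)}{\log y}\right|\le c_L|v-u|$ for all $u,v\in U$; (S') there exist $c_x>0$ and $\zeta_x$ with $\zeta_x\gamma(x)>1$ such that $\sup_{t\ge1}t^{\zeta_x}\left|\overline F^x(t)-c_x\log(t)t^{-1/\gamma(x)}\right|<\infty$. Then there exist sequences $\{(k_n,h_n,r_n,\ell_n),n\in\mathbb N\}$ (with $k_n$, $r_n$, $\ell_n$ intermediate, $h_n>0$, and $u_n=F^{\leftarrow,x}(1-k_n/n)$) such that all of the following hold as $n\to\infty$: (i) $h_n\log(u_n)\to0$; (ii) $nh_n\overline F^x(u_n)=k_nh_n\to\infty$; (iii) $r_nh_n\overline F^x(u_n)=r_nh_nk_n/n\to0$; (iv) $\lim1/\ell_n=\lim\ell_n/r_n=\lim r_n/n=\lim(n/r_n)\beta_{\ell_n}=0$; (v) $\sqrt{k_nh_n}\{g(x)-g_n(x)\}\to0$ in probability; (vi) there exists $s_0\in(0,1)$ such that $\sqrt{k_nh_n}\,B_n^x(s_0)\to0$;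 (vii) $\sqrt{k_nh_n}\int_1^\infty\frac{\mathbb E[\widetilde V_n^x(t)]-t^{-1/\gamma(x)}g(x)}{t}\,dt\to0$.
   Context: $\{(X_j,Y_j)\}_{j\in\mathbb Z}$ is a stationary time series of real random variables with $Y_j>0$. $X_0$ has a twice continuously differentiable density $g$, and for all $i\neq j$ the pair $(X_i,X_j)$ has a joint density which is bounded. $F^u$ denotes the conditional distribution function of $Y_0$ given $X_0=u$ and $\overline F^u=1-F^u$. $U\subseteq\mathbb R$ is open and $x\in U$ is fixed with $g(x)>0$. Conditional regular variation: for all $u\in U$, $\overline F^u(y)=L^u(y)y^{-1/\gamma(u)}$ for $y>0$, where $\gamma(u)>0$ and $L^u$ is slowly varying at infinity. $K$ is a bounded probability density supported on $[-1,1]$. An integer sequence $a_n\le n$ is called intermediate if $a_n\to\infty$ and $a_n/n\to0$. $F^{\leftarrow,x}$ is the generalised inverse of $F^x$. For given $k_n,h_n$ and $u_n=F^{\leftarrow,x}(1-k_n/n)$ put $K_{n,j}=K\left(\frac{x-X_j}{h_n}\right)$, $g_n(x)=\frac1{nh_n}\sum_{j=1}^nK_{n,j}$, $\widetilde V_n^x(s)=\frac{1}{nh_n\overline F^x(u_n)}\sum_{j=1}^nK_{n,j}1_{\{Y_j>su_n\}}$, and $B_n^x(s_0)=\sup_{t\ge s_0}|\mathbb E[\widetilde V_n^x(t)]-t^{-1/\gamma(x)}g(x)|$. Mixing coefficients: with $\mathcal F_a^b=\sigma((X_j,Y_j):a\le j\le b)$, $\alpha(n)=\sup\{|\Pr(A\cap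 B)-\Pr(A)\Pr(B)|:A\in\mathcal F_{-\infty}^0,B\in\mathcal F_n^\infty\}$ and $\beta(n)=\beta_n=\sup\frac12\sum_i\sum_j|\Pr(A_i\cap B_j)-\Pr(A_i)\Pr(B_j)|$ over all finite partitions $(A_i)\subset\mathcal F_{-\infty}^0$, $(B_j)\subset\mathcal F_n^\infty$ of the sample space; $\beta$-mixing means $\beta(n)\to0$. *)

theory Defs
  imports "HOL-Probability.Probability" "HOL-Library.Landau_Symbols"
begin

definition strictly_stationary ::
  "'a measure \<Rightarrow> (int \<Rightarrow> 'a \<Rightarrow> real \<times> real) \<Rightarrow> bool" where
  "strictly_stationary M Z \<longleftrightarrow>
     (\<forall>J m. finite J \<longrightarrow>
        distr M (\<Pi>\<^sub>M j\<in>J. borel) (\<lambda>\<omega>. \<lambda>j\<in>J. Z (j + m) \<omega>) =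
        distr M (\<Pi>\<^sub>M j\<in>J. borel) (\<lambda>\<omega>. \<lambda>j\<in>J. Z j \<omega>))"

definition sigma_gen_by ::
  "'a measure \<Rightarrow> (int \<Rightarrow> 'a \<Rightarrow> real \<times> real) \<Rightarrow> int set \<Rightarrow> 'a set set" where
  "sigma_gen_by M Z I =
     sigma_sets (space M) {Z j -` S \<inter> space M | j S. j \<in> I \<and> S \<in> sets borel}"

definition alpha_coeff ::
  "'a measure \<Rightarrow> (int \<Rightarrow> 'a \<Rightarrow> real \<times> real) \<Rightarrow> nat \<Rightarrow> real" where
  "alpha_coeff M Z n =
     Sup {\<bar>measure M (A \<inter> B) - measure M A * measure M B\<bar> | A B.
            A \<in> sigma_gen_by M Z {..0} \<and> B \<in> sigma_gen_by M Z {int n..}}"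

(* partition_on excludes empty blocks; these would contribute 0 to the sums. *)
definition beta_coeff ::
  "'a measure \<Rightarrow> (int \<Rightarrow> 'a \<Rightarrow> real \<times> real) \<Rightarrow> nat \<Rightarrow> real" where
  "beta_coeff M Z n =
     Sup {1 / 2 * (\<Sum>A\<in>P. \<Sum>B\<in>Q. \<bar>measure M (A \<inter> B) - measure M A * measure M B\<bar>) | P Q.
            finite P \<and> partition_on (space M) P \<and> P \<subseteq> sigma_gen_by M Z {..0} \<and>
            finite Q \<and> partition_on (space M) Q \<and> Q \<subseteq> sigma_gen_by M Z {int n..}}"

definition twice_cont_diff :: "(real \<Rightarrow> real) \<Rightarrow> bool" where
  "twice_cont_diff g \<longleftrightarrow>
     (\<exists>g' g''. (\<forall>u. (g has_real_derivative g' u) (at u)) \<and>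
               (\<forall>u. (g' has_real_derivative g'' u) (at u)) \<and>
               continuous_on UNIV g'')"

definition has_bounded_joint_density ::
  "'a measure \<Rightarrow> ('a \<Rightarrow> real) \<Rightarrow> ('a \<Rightarrow> real) \<Rightarrow> bool" where
  "has_bounded_joint_density M V W \<longleftrightarrow>
     (\<exists>f C. distributed M (lborel \<Otimes>\<^sub>M lborel) (\<lambda>\<omega>. (V \<omega>, W \<omega>)) f \<and>
            (\<forall>z. f z \<le> ennreal C))"

(* F u is the distribution function of a (fixed version of a) regular conditional
   distribution \<kappa> u of W given V = u. *)
definition conditional_cdf ::
  "'a measure \<Rightarrow> ('a \<Rightarrow> real) \<Rightarrow> ('a \<Rightarrow> real) \<Rightarrow> (real \<Rightarrow> real \<Rightarrow> real) \<Rightarrow> bool" where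
  "conditional_cdf M V W F \<longleftrightarrow>
     (\<exists>\<kappa>. \<kappa> \<in> borel \<rightarrow>\<^sub>M prob_algebra borel \<and>
          (\<forall>A\<in>sets borel. \<forall>B\<in>sets borel.
             emeasure M {\<omega> \<in> space M. V \<omega> \<in> A \<and> W \<omega> \<in> B} =
             (\<integral>\<^sup>+ u\<in>A. emeasure (\<kappa> u) B \<partial>distr M borel V)) \<and>
          (\<forall>u. F u = cdf (\<kappa> u)))"

definition survival :: "(real \<Rightarrow> real) \<Rightarrow> real \<Rightarrow> real" where
  "survival G y = 1 - G y"

(* Meaningful for 0 < p < 1; outside that range the infimum may be over an empty or
   unbounded set and then has no significance. *)
definition gen_inverse :: "(real \<Rightarrow> real) \<Rightarrow> real \<Rightarrow> real" where
  "gen_inverse G p = Inf {y. p \<le> G y}"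

definition slowly_varying :: "(real \<Rightarrow> real) \<Rightarrow> bool" where
  "slowly_varying L \<longleftrightarrow>
     set_borel_measurable borel {0<..} L \<and> (\<forall>y>0. L y > 0) \<and>
     (\<forall>t>0. ((\<lambda>y. L (t * y) / L y) \<longlongrightarrow> 1) at_top)"

definition intermediate :: "(nat \<Rightarrow> nat) \<Rightarrow> bool" where
  "intermediate a \<longleftrightarrow>
     (\<forall>n. a n \<le> n) \<and> filterlim a at_top sequentially \<and>
     (\<lambda>n. real (a n) / real n) \<longlonglongrightarrow> 0"

definition tendsto_in_prob :: "'a measure \<Rightarrow> (nat \<Rightarrow> 'a \<Rightarrow> real) \<Rightarrow> real \<Rightarrow> bool" where
  "tendsto_in_prob M Z c \<longleftrightarrow>
     (\<forall>\<epsilon>>0. (\<lambda>n. measure M {\<omega> \<in> space M. \<bar>Z n \<omega> - c\<bar> > \<epsilon>}) \<longlonglongrightarrow> 0)"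

definition kernel_density :: "(real \<Rightarrow> real) \<Rightarrow> bool" where
  "kernel_density K \<longleftrightarrow>
     K \<in> borel_measurable borel \<and> (\<forall>t. 0 \<le> K t) \<and> bounded (range K) \<and>
     (\<forall>t. t \<notin> {-1..1} \<longrightarrow> K t = 0) \<and> integrable lborel K \<and> (LINT t|lborel. K t) = 1"

definition dens_est ::
  "(int \<Rightarrow> 'a \<Rightarrow> real) \<Rightarrow> (real \<Rightarrow> real) \<Rightarrow> real \<Rightarrow> real \<Rightarrow> nat \<Rightarrow> 'a \<Rightarrow> real" where
  "dens_est X K x h n \<omega> =
     1 / (real n * h) * (\<Sum>j=1..n. K ((x - X (int j) \<omega>) / h))"

definition V_tilde ::
  "(int \<Rightarrow> 'a \<Rightarrow> real) \<Rightarrow> (int \<Rightarrow> 'a \<Rightarrow> real) \<Rightarrow> (real \<Rightarrow> real) \<Rightarrow> (real \<Rightarrow> real \<Rightarrow> real) \<Rightarrow>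
   real \<Rightarrow> real \<Rightarrow> real \<Rightarrow> nat \<Rightarrow> real \<Rightarrow> 'a \<Rightarrow> real" where
  "V_tilde X Y K F x h u n s \<omega> =
     1 / (real n * h * survival (F x) u) *
     (\<Sum>j=1..n. K ((x - X (int j) \<omega>) / h) * (if Y (int j) \<omega> > s * u then 1 else 0))"

definition V_bias ::
  "'a measure \<Rightarrow> (int \<Rightarrow> 'a \<Rightarrow> real) \<Rightarrow> (int \<Rightarrow> 'a \<Rightarrow> real) \<Rightarrow> (real \<Rightarrow> real) \<Rightarrow>
   (real \<Rightarrow> real \<Rightarrow> real) \<Rightarrow> (real \<Rightarrow> real) \<Rightarrow> (real \<Rightarrow> real) \<Rightarrow>
   real \<Rightarrow> real \<Rightarrow> real \<Rightarrow> nat \<Rightarrow> real \<Rightarrow> real" where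
  "V_bias M X Y K F \<gamma> g x h u n t =
     (\<integral>\<omega>. V_tilde X Y K F x h u n t \<omega> \<partial>M) - t powr (- 1 / \<gamma> x) * g x"

(* For s0 > 0 the supremum is over a bounded set whenever K is bounded, so the real-valued
   supremum is the true one. *)
definition B_sup ::
  "'a measure \<Rightarrow> (int \<Rightarrow> 'a \<Rightarrow> real) \<Rightarrow> (int \<Rightarrow> 'a \<Rightarrow> real) \<Rightarrow> (real \<Rightarrow> real) \<Rightarrow>
   (real \<Rightarrow> real \<Rightarrow> real) \<Rightarrow> (real \<Rightarrow> real) \<Rightarrow> (real \<Rightarrow> real) \<Rightarrow>
   real \<Rightarrow> real \<Rightarrow> real \<Rightarrow> nat \<Rightarrow> real \<Rightarrow> real" where
  "B_sup M X Y K F \<gamma> g x h u n s0 = (SUP t\<in>{s0..}. \<bar>V_bias M X Y K F \<gamma> g x h u n t\<bar>)"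

end

theory Submission
  imports Defs "HOL-Real_Asymp.Real_Asymp"
begin

text \<open>
Write \<open>\<rho> = 1 / \<gamma> x\<close> and \<open>S\<close> for the survival function at \<open>x\<close>. By the second-order condition \<open>S t\<close> is
\<open>c\<^sub>x * ln t * t powr (-\<rho>)\<close> up to a term without the logarithm. Hence
\<open>S (t * u) / S u\<close> differs from \<open>t powr (-\<rho>)\<close> by an amount of order \<open>1 / ln u\<close> (\<open>log_tail_ratio\<close>), and no
faster rate can be expected. Localisation adds a second error: the survival functions at \<open>x\<close> and at a
point within distance \<open>h\<close> have a quotient \<open>exp \<theta>\<close> with \<open>\<theta>\<close> of order \<open>h * ln (t * u)\<close>
(\<open>conditional_tail_perturbation\<close>). Together with the local Lipschitz continuity of \<open>g\<close> this bounds the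
bias of the tail estimator, for all \<open>t \<ge> 1/2\<close>, by a multiple of
\<open>(1 / ln u + h * ln u) * t powr (-\<rho>/2)\<close> (\<open>bias_rate\<close>). The loss of half of the decay in \<open>t\<close> pays for all
factors \<open>ln t\<close> and leaves a bound that is bounded on \<open>{1/2..}\<close> and integrable against \<open>dt/t\<close>, so that one
estimate serves both the supremum and the integral.

It remains to choose the sequences. The quantile \<open>u n\<close> satisfies \<open>S (u n) = k n / n\<close> because \<open>F x\<close> is
continuous, and then \<open>ln (u n)\<close> has exact order \<open>ln n\<close> as soon as \<open>k n\<close> is a small power of \<open>n\<close>
(\<open>quantile_log_growth\<close>). The bias is negligible if \<open>k * h\<close> is of smaller order than \<open>(ln n)\<^sup>2\<close> and \<open>h\<close>
decays like a power of \<open>n\<close>. Taking \<open>k = n powr (1/4)\<close> and \<open>h\<close> of order \<open>ln n * n powr (-1/4)\<close> makes \<open>k * h\<close> of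
order \<open>ln n\<close>, which still diverges.

The density estimator is treated by its second moment. The polynomial \<open>\<alpha>\<close>-mixing rate is summable, so
covariances of kernel weights sum up to \<open>O(n)\<close> (\<open>stationary_sum_second_moment\<close>) and the variance of the
estimator is \<open>O(1 / (n * h\<^sup>2))\<close>, a negative power of \<open>n\<close> up to logarithms for this bandwidth.

For the blocks, \<open>k * h / n\<close> is so close to \<open>1 / n\<close> that any \<open>r = n powr (1 - e)\<close> with \<open>e > 0\<close> is admissible.
With \<open>l = n powr (1/2)\<close> the number of blocks times the \<open>\<beta>\<close>-mixing coefficient is
\<open>O(n powr (e - \<nu>/2))\<close>, so \<open>e\<close> is chosen below \<open>\<nu>/2\<close>.
\<close>

section \<open>Tails with a logarithmic factor\<close>

text \<open>
The bounds on the bias carry two logarithmic factors in \<open>t\<close> and a small excess power, the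
latter because conditional tails at nearby points have slightly different indices. All of this
is paid for by giving up half of the decay \<open>t powr (-\<rho>)\<close>, uniformly on the half-line
\<open>t \<ge> 1/2\<close>. Half of the decay is still integrable against \<open>dt/t\<close>.
\<close>

lemma log_growth_absorbed:
  fixes \<rho> t :: real
  assumes "\<rho> > 0" "t \<ge> 1/2"
  shows "(1 + \<bar>ln t\<bar>)\<^sup>2 * (2 * t) powr (\<rho>/4) * t powr (-\<rho>)
           \<le> (2 + 8/\<rho>)\<^sup>2 * 2 powr (\<rho>/2) * t powr (-(\<rho>/2))"
proof -
  have t: "t > 0" "2 * t \<ge> 1" using assms by auto
  have "ln (2*t) \<le> (2*t) powr (\<rho>/8) / (\<rho>/8)"
    using ln_powr_bound[of "2*t" "\<rho>/8"] t assms by simp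
  moreover have "\<bar>ln t\<bar> \<le> ln (2*t) + 1"
  proof -
    have "ln (2*t) = ln 2 + ln t" using t by (simp add: ln_mult)
    moreover have "ln (2*t) \<ge> 0" using t by simp
    moreover have "ln 2 \<le> (1::real)" using ln2_le_25_over_36 by simp
    ultimately show ?thesis using ln_ge_zero[of 2] unfolding abs_le_iff by (intro conjI) linarith+
  qed
  moreover have "2 \<le> 2 * (2*t) powr (\<rho>/8)" using ge_one_powr_ge_zero[of "2*t" "\<rho>/8"] t assms by simp
  ultimately have "1 + \<bar>ln t\<bar> \<le> (2 + 8/\<rho>) * (2*t) powr (\<rho>/8)" by (simp add: field_simps)
  hence "(1 + \<bar>ln t\<bar>)\<^sup>2 \<le> ((2 + 8/\<rho>) * (2*t) powr (\<rho>/8))\<^sup>2" by (intro power_mono) auto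
  also have "\<dots> = (2 + 8/\<rho>)\<^sup>2 * (2*t) powr (\<rho>/4)"
    using t by (simp add: power_mult_distrib power2_eq_square flip: powr_add)
  finally have "(1 + \<bar>ln t\<bar>)\<^sup>2 * (2 * t) powr (\<rho>/4) * t powr (-\<rho>) \<le>
     (2 + 8/\<rho>)\<^sup>2 * (2*t) powr (\<rho>/4) * (2 * t) powr (\<rho>/4) * t powr (-\<rho>)"
    by (intro mult_right_mono) auto
  also have "\<dots> = (2 + 8/\<rho>)\<^sup>2 * (2*t) powr (\<rho>/2) * t powr (-\<rho>)"
    by (simp add: mult.assoc flip: powr_add)
  also have "\<dots> = (2 + 8/\<rho>)\<^sup>2 * 2 powr (\<rho>/2) * (t powr (\<rho>/2) * t powr (-\<rho>))"
    using t by (simp add: powr_mult)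
  also have "t powr (\<rho>/2) * t powr (-\<rho>) = t powr (-(\<rho>/2))"
    by (simp flip: powr_add)
  finally show ?thesis .
qed

text \<open>
Once \<open>ln u\<close> exceeds \<open>2 A / c\<close> the error term of the expansion is at most half of the main term.
The exponent \<open>\<zeta>\<close> only has to be at least \<open>\<rho>\<close>, since the logarithm alone separates the two terms.
\<close>

lemma log_tail_bounds:
  fixes S :: "real \<Rightarrow> real"
  assumes "c > 0" "\<zeta> \<ge> \<rho>"
    and R: "\<And>t. t \<ge> 1 \<Longrightarrow> \<bar>S t - c * ln t * t powr (-\<rho>)\<bar> \<le> A * t powr (-\<zeta>)"
    and u: "u \<ge> 1" "2 * A / c \<le> ln u"
  shows "c/2 * ln u * u powr (-\<rho>) \<le> S u" "S u \<le> 2 * c * ln u * u powr (-\<rho>)"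
proof -
  have "0 \<le> A" using R[of 1] by simp
  have "A * u powr (-\<zeta>) \<le> A * u powr (-\<rho>)"
    using \<open>0 \<le> A\<close> u assms by (intro mult_left_mono powr_mono) auto
  also have "A \<le> c/2 * ln u" using u \<open>c > 0\<close> by (simp add: field_simps)
  hence "A * u powr (-\<rho>) \<le> c/2 * ln u * u powr (-\<rho>)" by (intro mult_right_mono) auto
  finally have "\<bar>S u - c * ln u * u powr (-\<rho>)\<bar> \<le> c/2 * ln u * u powr (-\<rho>)" using R[OF u(1)] by simp
  moreover have "0 \<le> c/2 * ln u * u powr (-\<rho>)" using u \<open>c > 0\<close> by simp
  ultimately show "c/2 * ln u * u powr (-\<rho>) \<le> S u" "S u \<le> 2 * c * ln u * u powr (-\<rho>)"
    unfolding abs_le_iff by (auto simp: algebra_simps)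
qed

text \<open>
The main terms of \<open>S (t * u)\<close> and \<open>t powr (-\<rho>) * S u\<close> differ through \<open>ln (t * u) - ln u = ln t\<close>
only, whereas \<open>S u\<close> itself carries the factor \<open>ln u\<close>. This is why the second-order bias decays
merely like \<open>1 / ln u\<close>, and it is the reason for the slow growth imposed below on \<open>k * h\<close>.
\<close>

lemma log_tail_ratio:
  fixes S :: "real \<Rightarrow> real"
  assumes "c > 0" "\<zeta> \<ge> \<rho>"
    and R: "\<And>t. t \<ge> 1 \<Longrightarrow> \<bar>S t - c * ln t * t powr (-\<rho>)\<bar> \<le> A * t powr (-\<zeta>)"
    and u: "u > 1" "2 * A / c \<le> ln u" and t: "t > 0" "t * u \<ge> 1"
  shows "\<bar>S (t * u) / S u - t powr (-\<rho>)\<bar> \<le> (2 + 4 * A / c) * (1 + \<bar>ln t\<bar>) * t powr (-\<rho>) / ln u"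
proof -
  have "0 \<le> A" using R[of 1] by simp
  define Q where "Q = (\<lambda>t. S t - c * ln t * t powr (-\<rho>))"
  have Q: "\<bar>Q s\<bar> \<le> A * s powr (-\<rho>)" if "s \<ge> 1" for s
  proof -
    have "A * s powr (-\<zeta>) \<le> A * s powr (-\<rho>)"
      using \<open>0 \<le> A\<close> that assms by (intro mult_left_mono powr_mono) auto
    thus ?thesis using R[OF that] by (simp add: Q_def)
  qed
  have pm: "(t * u) powr (-\<rho>) = t powr (-\<rho>) * u powr (-\<rho>)" using t u by (simp add: powr_mult)
  have lnu: "ln u > 0" using u by simp
  have "S (t * u) - t powr (-\<rho>) * S u
      = c * ln t * (t powr (-\<rho>) * u powr (-\<rho>)) + Q (t * u) - t powr (-\<rho>) * Q u"
    using t u by (simp add: Q_def pm ln_mult algebra_simps)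
  also have "\<bar>\<dots>\<bar> \<le> \<bar>c * ln t * (t powr (-\<rho>) * u powr (-\<rho>))\<bar> + \<bar>Q (t * u)\<bar> + \<bar>t powr (-\<rho>) * Q u\<bar>"
    by linarith
  also have "\<dots> \<le> c * \<bar>ln t\<bar> * (t powr (-\<rho>) * u powr (-\<rho>)) + A * (t powr (-\<rho>) * u powr (-\<rho>))
       + t powr (-\<rho>) * (A * u powr (-\<rho>))"
    using Q[of "t*u"] Q[of u] t u \<open>c > 0\<close>
    by (intro add_mono) (auto simp: abs_mult pm intro!: mult_left_mono)
  also have "\<dots> = (c * \<bar>ln t\<bar> + 2 * A) * t powr (-\<rho>) * u powr (-\<rho>)" by (simp add: algebra_simps)
  finally have num: "\<bar>S (t * u) - t powr (-\<rho>) * S u\<bar> \<le> (c * \<bar>ln t\<bar> + 2 * A) * t powr (-\<rho>) * u powr (-\<rho>)" .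
  have den: "c/2 * ln u * u powr (-\<rho>) \<le> S u"
    using log_tail_bounds(1)[OF assms(1,2) R, of u] u by simp
  have pos: "0 < c/2 * ln u * u powr (-\<rho>)" using lnu \<open>c > 0\<close> u by simp
  have Su: "S u > 0" using den pos by linarith
  have "\<bar>S (t * u) / S u - t powr (-\<rho>)\<bar> = \<bar>S (t * u) - t powr (-\<rho>) * S u\<bar> / S u"
    using Su by (simp add: field_simps abs_divide[symmetric] del: abs_divide) (simp add: abs_divide)
  also have "\<dots> \<le> (c * \<bar>ln t\<bar> + 2 * A) * t powr (-\<rho>) * u powr (-\<rho>) / (c/2 * ln u * u powr (-\<rho>))"
    using num den pos by (intro frac_le) auto
  also have "\<dots> = (2 * \<bar>ln t\<bar> + 4 * A / c) * (t powr (-\<rho>) / ln u)"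
    using pos lnu \<open>c > 0\<close> u by (simp add: field_simps)
  also have "\<dots> \<le> ((2 + 4 * A / c) * (1 + \<bar>ln t\<bar>)) * (t powr (-\<rho>) / ln u)"
  proof (intro mult_right_mono)
    have "0 \<le> 4 * A / c" using \<open>0 \<le> A\<close> \<open>c > 0\<close> by simp
    hence "0 \<le> 4 * A / c * \<bar>ln t\<bar>" by (rule mult_nonneg_nonneg) simp
    thus "2 * \<bar>ln t\<bar> + 4 * A / c \<le> (2 + 4 * A / c) * (1 + \<bar>ln t\<bar>)"
      unfolding distrib_left distrib_right by linarith
  qed (use lnu in auto)
  finally show ?thesis by simp
qed

section \<open>Conditional tails near the centre\<close>

text \<open>
The logarithm of the quotient of the two tails is at most \<open>d = (d1 + d2) * ln y\<close> in absolute value,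
and \<open>\<bar>exp \<theta> - 1\<bar> \<le> d * exp d\<close> for \<open>\<bar>\<theta>\<bar> \<le> d\<close>. The factor \<open>exp d\<close> is the power of \<open>y\<close> in the bound; it
cannot be replaced by a constant, because \<open>y\<close> runs through an unbounded set for fixed \<open>d1\<close> and \<open>d2\<close>.
\<close>

lemma conditional_tail_perturbation:
  fixes Sx Sv Lx Lv a b :: real
  assumes "y > 1" "Lx > 0" "Lv > 0"
    and "Sx = Lx * y powr (- a)" "Sv = Lv * y powr (- b)"
    and "\<bar>a - b\<bar> \<le> d1" "\<bar>(ln Lv - ln Lx) / ln y\<bar> \<le> d2"
  shows "\<bar>Sv - Sx\<bar> \<le> Sx * ((d1 + d2) * ln y * y powr (d1 + d2))"
proof -
  have lny: "ln y > 0" using assms by simp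
  define \<theta> where "\<theta> = ln Lv - ln Lx + (a - b) * ln y"
  define d where "d = (d1 + d2) * ln y"
  have "\<bar>ln Lv - ln Lx\<bar> \<le> d2 * ln y" using assms(7) lny by (simp add: field_simps abs_divide)
  moreover have "\<bar>(a - b) * ln y\<bar> \<le> d1 * ln y" using assms(6) lny by (simp add: abs_mult)
  ultimately have th: "\<bar>\<theta>\<bar> \<le> d" unfolding \<theta>_def d_def distrib_right by linarith
  have Sx: "Sx > 0" using assms by simp
  have "Sv = exp (ln Lv - b * ln y)" "Sx = exp (ln Lx - a * ln y)"
    using assms by (simp_all add: powr_def exp_diff exp_minus field_simps)
  hence "Sv = Sx * exp \<theta>" by (simp add: \<theta>_def algebra_simps flip: exp_add)
  hence "Sv - Sx = Sx * (exp \<theta> - 1)" by (simp add: algebra_simps)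
  hence "\<bar>Sv - Sx\<bar> = Sx * \<bar>exp \<theta> - 1\<bar>" using Sx by (simp add: abs_mult)
  also have "\<bar>exp \<theta> - 1\<bar> \<le> d * exp d"
  proof -
    have "1 - exp \<theta> \<le> - \<theta>" using exp_ge_add_one_self[of \<theta>] by linarith
    moreover have "1 - exp (-\<theta>) \<le> \<theta>" using exp_ge_add_one_self[of "-\<theta>"] by simp
    hence "exp \<theta> - 1 \<le> \<theta> * exp \<theta>"
      using mult_right_mono[of "1 - exp (-\<theta>)" \<theta> "exp \<theta>"] by (simp add: left_diff_distrib flip: exp_add)
    moreover have "\<theta> * exp \<theta> \<le> d * exp \<theta>" "d * exp \<theta> \<le> d * exp d" using th
      by (auto intro!: mult_right_mono mult_left_mono)
    moreover have "d \<le> d * exp d" using th by (simp add: mult_le_cancel_left1)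
    ultimately show ?thesis using th by linarith
  qed
  hence "Sx * \<bar>exp \<theta> - 1\<bar> \<le> Sx * (d * exp d)" using Sx by simp
  also have "exp d = y powr (d1 + d2)" using assms by (simp add: d_def powr_def)
  finally show ?thesis by (simp add: d_def)
qed

text \<open>
Three errors are superposed: replacing the conditional tail at a nearby point by the tail \<open>S\<close> at the
centre costs \<open>h * ln u\<close>, replacing the quotient of tails by its limit costs \<open>1 / ln u\<close>, and replacing
the density at the nearby point by its value at the centre costs \<open>h\<close>, which is at most \<open>h * ln u\<close>.
The factors depending on \<open>t\<close> are collected in \<open>E = (1 + \<bar>ln t\<bar>)\<^sup>2 * (2 * t) powr (\<rho>/4) * t powr (-\<rho>)\<close>.
\<close>

lemma quotient_bias_bound:
  fixes S Sv :: "real \<Rightarrow> real"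
  assumes "\<rho> > 0" "c > 0" "\<zeta> \<ge> \<rho>" "D \<ge> 0" "gx \<ge> 0" "G \<ge> 0"
    and R: "\<And>t. t \<ge> 1 \<Longrightarrow> \<bar>S t - c * ln t * t powr (-\<rho>)\<bar> \<le> A * t powr (-\<zeta>)"
    and per: "\<bar>Sv (t * u) - S (t * u)\<bar> \<le> S (t * u) * (D * h * ln (t * u) * (t * u) powr (D * h))"
    and gv: "\<bar>gv - gx\<bar> \<le> G * h"
    and h: "0 < h" "h \<le> 1" "D * h \<le> \<rho>/4" "D * h * ln u \<le> 1"
    and u: "2 * A / c \<le> ln u" "1 \<le> ln u" "u \<ge> 2"
    and t: "t \<ge> 1/2"
  shows "\<bar>Sv (t * u) / S u * gv - t powr (-\<rho>) * gx\<bar>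
    \<le> (gx + G) * (3 + 4 * A / c) * (2 + 3 * D) * ((2 + 8/\<rho>)\<^sup>2 * 2 powr (\<rho>/2)) * t powr (-(\<rho>/2)) * (1 / ln u + h * ln u)"
proof -
  have "0 \<le> A" using R[of 1] by simp
  have tu: "t > 0" "t * u \<ge> 1" "2*t \<ge> 1" "u > 1" "u > 0"
    using t u mult_mono[of "1/2" t 2 u] by auto
  define C where "C = 2 + 4 * A / c"
  have C: "C \<ge> 2" using \<open>0 \<le> A\<close> \<open>c > 0\<close> by (simp add: C_def)
  define p where "p = 1 + \<bar>ln t\<bar>"
  have p: "p \<ge> 1" by (simp add: p_def)
  define q where "q = (2*t) powr (\<rho>/4)"
  have q: "q \<ge> 1" using tu assms by (simp add: q_def ge_one_powr_ge_zero)
  define T where "T = t powr (-\<rho>)"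
  have T: "T > 0" using tu by (simp add: T_def)
  define E where "E = p\<^sup>2 * q * T"
  have E: "E \<le> (2 + 8/\<rho>)\<^sup>2 * 2 powr (\<rho>/2) * t powr (-(\<rho>/2))"
    using log_growth_absorbed[OF assms(1) t] by (simp add: E_def p_def q_def T_def)
  have pp: "p \<le> p\<^sup>2 * q" "1 \<le> p\<^sup>2 * q"
  proof -
    have "p * 1 \<le> p * p" using p by (intro mult_left_mono) auto
    moreover have "p * p * 1 \<le> p * p * q" using p q by (intro mult_left_mono) auto
    ultimately show "p \<le> p\<^sup>2 * q" by (simp add: power2_eq_square)
    thus "1 \<le> p\<^sup>2 * q" using p by linarith
  qed
  have pT: "p * T \<le> E" "T \<le> E" 
    using mult_right_mono[OF pp(1), of T] mult_right_mono[OF pp(2), of T] T by (auto simp: E_def)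
  have Epos: "E > 0" using pT T by linarith
  have ratio: "\<bar>S (t * u) / S u - T\<bar> \<le> C * p * T / ln u"
    using log_tail_ratio[OF assms(2,3) R tu(4) u(1) tu(1,2)] by (simp add: C_def p_def T_def)
  also have "\<dots> \<le> C * p * T" using divide_left_mono[of 1 "ln u" "C * p * T"] C p T u by simp
  finally have "S (t * u) / S u \<le> T + C * p * T" by linarith
  also have "\<dots> \<le> (C + 1) * p * T" using p T mult_right_mono[of 1 p T] by (simp add: algebra_simps)
  finally have rat: "S (t * u) / S u \<le> (C + 1) * p * T" .
  have Su: "S u > 0"
  proof -
    have "0 < c/2 * ln u * u powr (-\<rho>)" using u \<open>c > 0\<close> tu by simp
    also have "\<dots> \<le> S u" using log_tail_bounds(1)[OF assms(2,3) R _ u(1)] tu by simp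
    finally show ?thesis .
  qed
  have lntu: "ln (t * u) \<le> p * ln u"
  proof -
    have "ln (t*u) = ln t + ln u" using tu by (simp add: ln_mult)
    also have "\<dots> \<le> \<bar>ln t\<bar> * 1 + ln u" by simp
    also have "\<dots> \<le> \<bar>ln t\<bar> * ln u + ln u" using u by (intro add_right_mono mult_left_mono) auto
    finally show ?thesis by (simp add: p_def algebra_simps)
  qed
  \<comment> \<open>The excess power splits into a power of \<open>t\<close>, absorbed by the decay, and one of \<open>u\<close>, at most \<open>exp 1\<close>.\<close>
  have pow: "(t * u) powr (D * h) \<le> 3 * q"
  proof -
    have Dh: "D * h \<ge> 0" using assms by simp
    have "(t * u) powr (D * h) = t powr (D*h) * u powr (D * h)" using tu by (simp add: powr_mult)
    also have "\<dots> \<le> q * 3"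
    proof (intro mult_mono)
      have "t powr (D * h) \<le> (2 * t) powr (D * h)" using Dh tu by (intro powr_mono2) auto
      also have "\<dots> \<le> q" unfolding q_def using h tu by (intro powr_mono) auto
      finally show "t powr (D * h) \<le> q" .
      have "u powr (D * h) = exp (D * h * ln u)" using tu by (simp add: powr_def)
      also have "\<dots> \<le> exp 1" using h by simp
      also have "\<dots> \<le> 3" by (rule exp_le)
      finally show "u powr (D * h) \<le> 3" .
    qed (use q in auto)
    finally show ?thesis by (simp add: mult.commute)
  qed
  have pert: "\<bar>Sv (t * u) / S u - S (t * u) / S u\<bar> \<le> (C+1) * (3 * D) * (h * ln u) * E"
  proof -
    have "\<bar>Sv (t * u) / S u - S (t * u) / S u\<bar> = \<bar>Sv (t * u) - S (t * u)\<bar> / S u"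
      using Su by (simp flip: diff_divide_distrib)
    also have "\<dots> \<le> S (t * u) * (D * h * ln (t * u) * (t * u) powr (D * h)) / S u"
      using per Su by (intro divide_right_mono) auto
    also have "\<dots> = S (t * u) / S u * (D * h * ln (t * u) * (t * u) powr (D * h))" by simp
    also have "\<dots> \<le> ((C + 1) * p * T) * ((D * h * (p * ln u)) * (3 * q))"
    proof (rule mult_mono[OF rat])
      show "D * h * ln (t * u) * (t * u) powr (D * h) \<le> (D * h * (p * ln u)) * (3 * q)"
        using lntu pow \<open>D \<ge> 0\<close> h p u tu by (intro mult_mono[OF _ pow] mult_left_mono) auto
    qed (use C p T \<open>D \<ge> 0\<close> h tu in auto)
    also have "\<dots> = (C+1) * (3 * D) * (h * ln u) * E" by (simp add: E_def power2_eq_square algebra_simps)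
    finally show ?thesis .
  qed
  define \<epsilon> where "\<epsilon> = 1 / ln u + h * ln u"
  have eps: "h * ln u \<le> \<epsilon>" "1 / ln u \<le> \<epsilon>" "h \<le> \<epsilon>" "0 \<le> \<epsilon>"
  proof -
    show 1: "h * ln u \<le> \<epsilon>" and "1 / ln u \<le> \<epsilon>" using h u by (auto simp: \<epsilon>_def)
    have "h * 1 \<le> h * ln u" using h u by (intro mult_left_mono) auto
    thus "h \<le> \<epsilon>" "0 \<le> \<epsilon>" using 1 \<open>0 < h\<close> by linarith+
  qed
  have "\<bar>Sv (t * u) / S u - T\<bar> \<le> (C+1) * (3 * D) * (h * ln u) * E + C * p * T / ln u"
    using pert ratio by linarith
  also have "\<dots> \<le> (C+1) * (3 * D) * \<epsilon> * E + (C+1) * (1 * \<epsilon>) * E"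
  proof (rule add_mono)
    show "(C+1) * (3 * D) * (h * ln u) * E \<le> (C+1) * (3 * D) * \<epsilon> * E"
      using eps Epos C \<open>D \<ge> 0\<close> by (intro mult_right_mono mult_left_mono) auto
    have "C * p * T / ln u = C * (1 / ln u) * (p * T)" by simp
    also have "\<dots> \<le> (C + 1) * \<epsilon> * E"
      using eps pT C p T u by (intro mult_mono) auto
    finally show "C * p * T / ln u \<le> (C+1) * (1 * \<epsilon>) * E" by simp
  qed
  also have "\<dots> = (C + 1) * (1 + 3 * D) * \<epsilon> * E" by (simp add: algebra_simps)
  finally have main: "\<bar>Sv (t * u) / S u - T\<bar> \<le> (C + 1) * (1 + 3 * D) * \<epsilon> * E" .
  have gvb: "\<bar>gv\<bar> \<le> gx + G" using gv mult_left_mono[OF h(2) \<open>G \<ge> 0\<close>] \<open>gx \<ge> 0\<close> by linarith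
  have "Sv (t * u) / S u * gv - T * gx = (Sv (t * u) / S u - T) * gv + T * (gv - gx)"
    by (simp add: algebra_simps)
  also have "\<bar>\<dots>\<bar> \<le> \<bar>Sv (t * u) / S u - T\<bar> * \<bar>gv\<bar> + T * \<bar>gv - gx\<bar>"
    using T by (intro order.trans[OF abs_triangle_ineq]) (simp add: abs_mult)
  also have "\<dots> \<le> ((C + 1) * (1 + 3 * D) * \<epsilon> * E) * (gx + G) + E * ((gx + G) * \<epsilon>)"
  proof (intro add_mono mult_mono)
    have "G * h \<le> (gx + G) * \<epsilon>" using eps h \<open>G \<ge> 0\<close> \<open>gx \<ge> 0\<close> by (intro mult_mono) auto
    thus "\<bar>gv - gx\<bar> \<le> (gx + G) * \<epsilon>" using gv by linarith
  qed (use main gvb pT Epos C eps \<open>D \<ge> 0\<close> in auto)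
  also have "\<dots> = (gx + G) * ((C + 1) * (1 + 3 * D) + 1) * E * \<epsilon>" by (simp add: algebra_simps)
  also have "\<dots> \<le> (gx + G) * ((C + 1) * (2 + 3 * D)) * ((2 + 8/\<rho>)\<^sup>2 * 2 powr (\<rho>/2) * t powr (-(\<rho>/2))) * \<epsilon>"
    using C E Epos eps \<open>D \<ge> 0\<close> \<open>G \<ge> 0\<close> \<open>gx \<ge> 0\<close>
    by (intro mult_right_mono[OF mult_mono] mult_left_mono) (auto simp: algebra_simps)
  finally show ?thesis by (simp add: T_def C_def \<epsilon>_def mult.assoc)
qed

lemma derivative_imp_Lipschitz_at:
  fixes g :: "real \<Rightarrow> real"
  assumes "(g has_real_derivative g') (at x)"
  shows "\<exists>G d. G \<ge> 0 \<and> d > 0 \<and> (\<forall>v. \<bar>v - x\<bar> < d \<longrightarrow> \<bar>g v - g x\<bar> \<le> G * \<bar>v - x\<bar>)"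
proof -
  have "((\<lambda>v. (g v - g x) / (v - x)) \<longlongrightarrow> g') (at x)"
    using assms by (simp add: has_field_derivative_iff)
  hence "\<forall>\<^sub>F v in at x. dist ((g v - g x) / (v - x)) g' < 1" by (rule tendstoD) simp
  then obtain d where d: "d > 0" "\<And>v. v \<noteq> x \<Longrightarrow> \<bar>v - x\<bar> < d \<Longrightarrow> \<bar>(g v - g x) / (v - x) - g'\<bar> < 1"
    unfolding eventually_at by (auto simp: dist_real_def)
  have "\<bar>g v - g x\<bar> \<le> (\<bar>g'\<bar> + 1) * \<bar>v - x\<bar>" if "\<bar>v - x\<bar> < d" for v
  proof (cases "v = x")
    case False
    have "\<bar>(g v - g x) / (v - x)\<bar> \<le> \<bar>g'\<bar> + 1" using d(2)[OF False that] by linarith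
    thus ?thesis using False by (simp add: field_simps abs_divide)
  qed simp
  thus ?thesis using d(1) by (intro exI[of _ "\<bar>g'\<bar> + 1"] exI[of _ d]) auto
qed

text \<open>
The bias is controlled pointwise in the location \<open>v\<close> within distance \<open>h\<close> of \<open>x\<close>. Averaging over \<open>v\<close>
against the kernel preserves such a bound, so no further analysis of the kernel estimator is required.
The threshold \<open>u0\<close> is large enough that \<open>t * u \<ge> y\<^sub>0\<close> for all \<open>t \<ge> 1/2\<close>, which brings the
condition on the slowly varying parts into force.
\<close>

lemma bias_rate:
  fixes F L :: "real \<Rightarrow> real \<Rightarrow> real" and g \<gamma> :: "real \<Rightarrow> real"
  assumes g: "(g has_real_derivative g') (at x)" "g x \<ge> 0"
    and U: "open U" "x \<in> U"
    and \<gamma>: "\<gamma> x > 0"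
    and L: "\<And>u y. u \<in> U \<Longrightarrow> y > 0 \<Longrightarrow> L u y > 0"
    and F: "\<And>u y. u \<in> U \<Longrightarrow> y > 0 \<Longrightarrow> survival (F u) y = L u y * y powr (- 1 / \<gamma> u)"
    and C1: "c\<^sub>\<gamma>-lipschitz_on U (\<lambda>u. 1 / \<gamma> u)"
    and C3: "y\<^sub>0 > 1" "c\<^sub>L > 0"
      "\<And>u v y. u \<in> U \<Longrightarrow> v \<in> U \<Longrightarrow> y \<ge> y\<^sub>0 \<Longrightarrow>
         \<bar>(ln (L v y) - ln (L u y)) / ln y\<bar> \<le> c\<^sub>L * \<bar>v - u\<bar>"
    and c: "c > 0" "\<zeta> \<ge> 1 / \<gamma> x"
    and R: "\<And>t. t \<ge> 1 \<Longrightarrow> \<bar>survival (F x) t - c * ln t * t powr (- (1 / \<gamma> x))\<bar> \<le> A * t powr (-\<zeta>)"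
  shows "\<exists>C \<epsilon> u0. C \<ge> 0 \<and> \<epsilon> > 0 \<and> (\<forall>h u v t. 0 < h \<longrightarrow> h \<le> \<epsilon> \<longrightarrow> h * ln u \<le> \<epsilon> \<longrightarrow> u \<ge> u0 \<longrightarrow> \<bar>v - x\<bar> \<le> h \<longrightarrow> t \<ge> 1/2 \<longrightarrow>
     \<bar>survival (F v) (t * u) / survival (F x) u * g v - t powr (- 1 / \<gamma> x) * g x\<bar>
       \<le> C * (1 / ln u + h * ln u) * t powr (- (1 / \<gamma> x / 2)))"
proof -
  define \<rho> where "\<rho> = 1 / \<gamma> x"
  have \<rho>: "\<rho> > 0" using \<gamma> by (simp add: \<rho>_def)
  define D where "D = c\<^sub>\<gamma> + c\<^sub>L"
  have cg: "c\<^sub>\<gamma> \<ge> 0" using C1 by (rule lipschitz_on_nonneg)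
  have D: "D > 0" using cg C3 by (simp add: D_def)
  have A: "A \<ge> 0" using R[of 1] by simp
  obtain r where r: "r > 0" "\<And>v. \<bar>v - x\<bar> < r \<Longrightarrow> v \<in> U"
    using U by (auto simp: open_dist dist_real_def)
  obtain G d where G0: "G \<ge> 0" and d: "d > 0" and G: "\<And>v. \<bar>v - x\<bar> < d \<Longrightarrow> \<bar>g v - g x\<bar> \<le> G * \<bar>v - x\<bar>"
    using derivative_imp_Lipschitz_at[OF g(1)] by blast
  define \<epsilon> where "\<epsilon> = Min {r/2, d/2, 1, \<rho> / 4 / D, 1 / D}"
  have eps: "\<epsilon> > 0" "\<epsilon> \<le> r/2" "\<epsilon> \<le> d/2" "\<epsilon> \<le> 1" "D * \<epsilon> \<le> \<rho>/4" "D * \<epsilon> \<le> 1"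
  proof -
    show "\<epsilon> > 0" using r d D \<rho> by (simp add: \<epsilon>_def)
    show "\<epsilon> \<le> r/2" "\<epsilon> \<le> d/2" "\<epsilon> \<le> 1" by (simp_all add: \<epsilon>_def)
    have "\<epsilon> \<le> \<rho> / 4 / D" "\<epsilon> \<le> 1 / D" by (simp_all add: \<epsilon>_def)
    thus "D * \<epsilon> \<le> \<rho>/4" "D * \<epsilon> \<le> 1" using D by (simp_all add: field_simps)
  qed
  define u0 where "u0 = Max {2 * y\<^sub>0, 2, exp 1, exp (2 * A / c)}"
  define C where "C = (g x + G) * (3 + 4 * A / c) * (2 + 3 * D) * ((2 + 8/\<rho>)\<^sup>2 * 2 powr (\<rho>/2))"
  have C0: "C \<ge> 0" using A D g c G0 by (simp add: C_def)
  have main: "\<bar>survival (F v) (t * u) / survival (F x) u * g v - t powr (- 1 / \<gamma> x) * g x\<bar>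
       \<le> C * (1 / ln u + h * ln u) * t powr (- (1 / \<gamma> x / 2))"
    if h: "0 < h" "h \<le> \<epsilon>" "h * ln u \<le> \<epsilon>" and u: "u \<ge> u0" and v: "\<bar>v - x\<bar> \<le> h" and t: "t \<ge> 1/2" for h u v t
  proof -
    have u: "u \<ge> 2 * y\<^sub>0" "u \<ge> 2" "u \<ge> exp 1" "u \<ge> exp (2 * A / c)" using u by (auto simp: u0_def)
    have lu: "ln u \<ge> 1" "ln u \<ge> 2 * A / c" using u by (auto simp: ln_ge_iff)
    have y: "t * u \<ge> y\<^sub>0" using mult_mono[of "1/2" t "2 * y\<^sub>0" u] t u C3 by simp
    have vU: "v \<in> U" using v h eps r(1) by (intro r(2)) linarith
    have Gv: "\<bar>g v - g x\<bar> \<le> G * h"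
    proof -
      have "\<bar>v - x\<bar> < d" using v h eps d by linarith
      hence "\<bar>g v - g x\<bar> \<le> G * \<bar>v - x\<bar>" by (rule G)
      also have "\<dots> \<le> G * h" using v G0 by (intro mult_left_mono) auto
      finally show ?thesis .
    qed
    have "\<bar>survival (F v) (t * u) - survival (F x) (t * u)\<bar> \<le> survival (F x) (t * u) *
       ((c\<^sub>\<gamma> * h + c\<^sub>L * h) * ln (t * u) * (t * u) powr (c\<^sub>\<gamma> * h + c\<^sub>L * h))"
    proof (rule conditional_tail_perturbation)
      show "t * u > 1" using y C3 by simp
      show "L x (t * u) > 0" "L v (t * u) > 0" using y C3 U vU by (auto intro!: L)
      show "survival (F x) (t * u) = L x (t * u) * (t * u) powr - (1 / \<gamma> x)"
           "survival (F v) (t * u) = L v (t * u) * (t * u) powr - (1 / \<gamma> v)"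
        using F[of x "t * u"] F[of v "t * u"] U vU y C3 by simp_all
      have "\<bar>1 / \<gamma> x - 1 / \<gamma> v\<bar> \<le> c\<^sub>\<gamma> * \<bar>x - v\<bar>"
        using lipschitz_onD[OF C1 U(2) vU] by (simp add: dist_real_def)
      also have "\<dots> \<le> c\<^sub>\<gamma> * h" using v cg by (intro mult_left_mono) auto
      finally show "\<bar>1 / \<gamma> x - 1 / \<gamma> v\<bar> \<le> c\<^sub>\<gamma> * h" .
      have "\<bar>(ln (L v (t * u)) - ln (L x (t * u))) / ln (t * u)\<bar> \<le> c\<^sub>L * \<bar>v - x\<bar>"
        using C3(3)[OF U(2) vU y] .
      also have "\<dots> \<le> c\<^sub>L * h" using v C3 by (intro mult_left_mono) auto
      finally show "\<bar>(ln (L v (t * u)) - ln (L x (t * u))) / ln (t * u)\<bar> \<le> c\<^sub>L * h" .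
    qed
    hence per: "\<bar>survival (F v) (t * u) - survival (F x) (t * u)\<bar> \<le> survival (F x) (t * u) *
       (D * h * ln (t * u) * (t * u) powr (D * h))" by (simp add: D_def distrib_right)
    have "D * h \<le> D * \<epsilon>" "D * (h * ln u) \<le> D * \<epsilon>" using h D by (auto intro: mult_left_mono)
    hence Dh: "D * h \<le> \<rho>/4" "D * h * ln u \<le> 1" using eps unfolding mult.assoc by linarith+
    have "\<bar>survival (F v) (t * u) / survival (F x) u * g v - t powr (-\<rho>) * g x\<bar>
      \<le> C * t powr (-(\<rho>/2)) * (1 / ln u + h * ln u)"
      unfolding C_def
      by (rule quotient_bias_bound[where S = "survival (F x)" and Sv = "survival (F v)", OF \<rho> c(1) _ _ g(2) _ _ per Gv h(1) _ Dh lu(2,1) u(2) t])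
         (use D h eps c R G0 in \<open>auto simp: \<rho>_def\<close>)
    thus ?thesis by (simp add: \<rho>_def mult_ac)
  qed
  show ?thesis by (intro exI[of _ C] exI[of _ \<epsilon>] exI[of _ u0] conjI allI impI C0 eps(1) main)
qed

section \<open>Kernel averages and conditional distributions\<close>

text \<open>
The function \<open>v \<mapsto> K ((x - v) / h) / h\<close> is a probability density supported on \<open>{x - h..x + h}\<close>, so
an average against it cannot leave an interval that contains \<open>\<phi>\<close> on that set.
\<close>

lemma kernel_average_error:
  assumes "kernel_density K" "h > 0" and [measurable]: "\<phi> \<in> borel_measurable borel"
    and b: "\<And>v. \<bar>v - x\<bar> \<le> h \<Longrightarrow> \<bar>\<phi> v - a\<bar> \<le> b"
  shows "\<bar>(LINT v|lborel. K ((x - v) / h) * \<phi> v) / h - a\<bar> \<le> b"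
proof -
  have K: "K \<in> borel_measurable borel" "\<And>t. 0 \<le> K t" "\<And>t. t \<notin> {-1..1} \<Longrightarrow> K t = 0"
    "integrable lborel K" "(LINT t|lborel. K t) = 1"
    using assms(1) by (auto simp: kernel_density_def)
  note [measurable] = K(1)
  define k where "k = (\<lambda>v. K ((x - v) / h) / h)"
  have k_aff: "k = (\<lambda>v. K (x/h + (-1/h) * v) / h)" using \<open>h > 0\<close> by (auto simp: k_def fun_eq_iff field_simps)
  have k0: "k v \<ge> 0" for v using K(2) \<open>h > 0\<close> by (simp add: k_def)
  have [measurable]: "k \<in> borel_measurable borel" unfolding k_def by measurable
  have ki: "integrable lborel k" unfolding k_aff
    using lborel_integrable_real_affine[OF K(4), of "-1/h" "x/h"] \<open>h > 0\<close> by (intro integrable_divide) auto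
  have k1: "(LINT v|lborel. k v) = 1" unfolding k_aff
    using lborel_integral_real_affine[of "-1/h" K "x/h"] \<open>h > 0\<close> K(5) by simp
  have supp: "k v = 0" if "\<not> \<bar>v - x\<bar> \<le> h" for v
  proof -
    have "(x - v) / h \<notin> {-1..1}" using that \<open>h > 0\<close> by (auto simp: field_simps abs_le_iff)
    thus ?thesis using K(3) by (simp add: k_def)
  qed
  have le: "\<bar>k v * (\<phi> v - a)\<bar> \<le> k v * b" for v
    using b[of v] supp[of v] k0[of v] by (cases "\<bar>v - x\<bar> \<le> h") (auto simp: abs_mult intro: mult_left_mono)
  have kb: "integrable lborel (\<lambda>v. k v * b)" using ki by simp
  have kd: "integrable lborel (\<lambda>v. k v * (\<phi> v - a))"
    by (rule Bochner_Integration.integrable_bound[OF kb]) (use le in \<open>auto intro!: AE_I2 order.trans[OF le]\<close>)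
  have "(LINT v|lborel. k v * (\<phi> v - a)) = (LINT v|lborel. k v * \<phi> v) - a"
  proof -
    have "integrable lborel (\<lambda>v. k v * (\<phi> v - a) + k v * a)" using kd ki by auto
    hence "integrable lborel (\<lambda>v. k v * \<phi> v)" by (simp add: algebra_simps)
    thus ?thesis using ki k1 by (simp add: right_diff_distrib)
  qed
  moreover have "\<bar>LINT v|lborel. k v * (\<phi> v - a)\<bar> \<le> (LINT v|lborel. k v * b)"
    by (intro order.trans[OF integral_abs_bound] integral_mono) (use kd kb le in auto)
  moreover have "(LINT v|lborel. k v * b) = b" using k1 by simp
  moreover have "(LINT v|lborel. k v * \<phi> v) = (LINT v|lborel. K ((x - v) / h) * \<phi> v) / h"
    by (simp add: k_def)
  ultimately show ?thesis by linarith
qed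

lemma conditional_cdf_is_cdf:
  assumes "conditional_cdf M V W F"
  shows "\<exists>N. real_distribution N \<and> F u = cdf N"
proof -
  obtain \<kappa> where k: "\<kappa> \<in> borel \<rightarrow>\<^sub>M prob_algebra borel" "\<And>u. F u = cdf (\<kappa> u)"
    using assms unfolding conditional_cdf_def by blast
  have "\<kappa> u \<in> space (prob_algebra borel)" using measurable_space[OF k(1), of u] by simp
  hence "prob_space (\<kappa> u)" "sets (\<kappa> u) = sets borel" by (auto simp: space_prob_algebra)
  hence "real_distribution (\<kappa> u)" 
    unfolding real_distribution_def real_distribution_axioms_def by (simp add: sets_eq_imp_space_eq)
  thus ?thesis using k by blast
qed

text \<open>
For a fixed event \<open>W > s\<close> the defining identity of the conditional distribution says that the image
under \<open>V\<close> of the restriction of \<open>M\<close> to this event has density \<open>u \<mapsto> \<kappa> u {s<..}\<close> with respect to the law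
of \<open>V\<close>. Integrating \<open>f\<close> against both descriptions of this measure gives the formula.
\<close>

lemma conditional_tail_expectation:
  assumes "prob_space M" and [measurable]: "V \<in> borel_measurable M" "W \<in> borel_measurable M"
    and V: "distributed M lborel V (\<lambda>u. ennreal (g u))" and g: "\<And>u. 0 \<le> g u"
    and F: "conditional_cdf M V W F"
    and [measurable]: "f \<in> borel_measurable borel" and f: "\<And>u. 0 \<le> f u"
  shows "(\<lambda>v. survival (F v) s) \<in> borel_measurable borel"
    and "(\<integral>\<omega>. f (V \<omega>) * (if W \<omega> > s then 1 else 0) \<partial>M)
       = (LINT v|lborel. f v * (survival (F v) s * g v))"
proof -
  obtain \<kappa> where k[measurable]: "\<kappa> \<in> borel \<rightarrow>\<^sub>M prob_algebra borel" and
    dis: "\<And>A B. A \<in> sets borel \<Longrightarrow> B \<in> sets borel \<Longrightarrow>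
             emeasure M {\<omega> \<in> space M. V \<omega> \<in> A \<and> W \<omega> \<in> B} =
             (\<integral>\<^sup>+ u\<in>A. emeasure (\<kappa> u) B \<partial>distr M borel V)"
    and Fk: "\<And>u. F u = cdf (\<kappa> u)"
    using F unfolding conditional_cdf_def by blast
  have sp: "\<kappa> u \<in> space (prob_algebra borel)" for u using measurable_space[OF k, of u] by simp
  have ps: "prob_space (\<kappa> u)" and se: "sets (\<kappa> u) = sets borel" for u
    using sp[of u] by (auto simp: space_prob_algebra)
  have surv: "survival (F u) s = measure (\<kappa> u) {s<..}" for u
  proof -
    interpret prob_space "\<kappa> u" by (rule ps)
    have "space (\<kappa> u) = UNIV" using sets_eq_imp_space_eq[OF se] by simp
    moreover have "UNIV - {..s} = {s<..}" by auto
    ultimately show ?thesis using prob_compl[of "{..s}"] se by (simp add: survival_def Fk cdf_def)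
  qed
  have ksub[measurable]: "\<kappa> \<in> borel \<rightarrow>\<^sub>M subprob_algebra borel" by (rule measurable_prob_algebraD[OF k])
  have em[measurable]: "(\<lambda>u. emeasure (\<kappa> u) {s<..}) \<in> borel_measurable borel"
    by (rule measurable_compose[OF ksub measurable_emeasure_subprob_algebra]) simp
  have ms[measurable]: "(\<lambda>u. measure (\<kappa> u) {s<..}) \<in> borel_measurable borel"
    by (rule measurable_compose[OF ksub measurable_measure_subprob_algebra]) simp
  show "(\<lambda>v. survival (F v) s) \<in> borel_measurable borel" unfolding surv by (rule ms)
  have [measurable]: "g \<in> borel_measurable borel"
    using distributed_real_measurable[OF _ V] g by simp
  have eq: "distr (density M (indicator {\<omega>\<in>space M. W \<omega> > s})) borel V = density (distr M borel V) (\<lambda>u. emeasure (\<kappa> u) {s<..})"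
    (is "?L = ?R")
  proof (rule measure_eqI)
    fix A :: "real set" assume "A \<in> sets ?L"
    hence A[measurable]: "A \<in> sets borel" by simp
    have "emeasure ?L A = (\<integral>\<^sup>+\<omega>. indicator {\<omega>\<in>space M. W \<omega> > s} \<omega> * indicator (V -` A \<inter> space M) \<omega> \<partial>M)"
      by (simp add: emeasure_distr emeasure_density)
    also have "\<dots> = (\<integral>\<^sup>+\<omega>. indicator {\<omega>\<in>space M. V \<omega> \<in> A \<and> W \<omega> \<in> {s<..}} \<omega> \<partial>M)"
      by (intro nn_integral_cong) (auto split: split_indicator)
    also have "\<dots> = emeasure M {\<omega>\<in>space M. V \<omega> \<in> A \<and> W \<omega> \<in> {s<..}}" 
      by (intro nn_integral_indicator) measurable
    also have "\<dots> = emeasure ?R A" by (subst dis) (auto simp: emeasure_density)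
    finally show "emeasure ?L A = emeasure ?R A" .
  qed simp
  have "(\<integral>\<^sup>+\<omega>. ennreal (f (V \<omega>) * (if W \<omega> > s then 1 else 0)) \<partial>M) = (\<integral>\<^sup>+u. ennreal (f u) \<partial>?L)"
    by (subst nn_integral_distr, simp, simp, subst nn_integral_density)
       (auto intro!: nn_integral_cong split: split_indicator)
  also have "\<dots> = (\<integral>\<^sup>+u. emeasure (\<kappa> u) {s<..} * ennreal (f u) \<partial>distr M borel V)"
    unfolding eq by (subst nn_integral_density) auto
  also have "distr M borel V = distr M lborel V" by (rule distr_cong) auto
  also have "\<dots> = density lborel (\<lambda>u. ennreal (g u))" using V by (rule distributed_distr_eq_density)
  also have "(\<integral>\<^sup>+u. emeasure (\<kappa> u) {s<..} * ennreal (f u) \<partial>\<dots>)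
     = (\<integral>\<^sup>+u. ennreal (g u) * (emeasure (\<kappa> u) {s<..} * ennreal (f u)) \<partial>lborel)"
    by (subst nn_integral_density) auto
  also have "\<dots> = (\<integral>\<^sup>+u. ennreal (f u * (survival (F u) s * g u)) \<partial>lborel)"
  proof (intro nn_integral_cong)
    fix u
    interpret prob_space "\<kappa> u" by (rule ps)
    show "ennreal (g u) * (emeasure (\<kappa> u) {s<..} * ennreal (f u)) = ennreal (f u * (survival (F u) s * g u))"
      using f[of u] g[of u] by (simp add: surv emeasure_eq_measure mult_ac flip: ennreal_mult)
  qed
  finally have nn: "(\<integral>\<^sup>+\<omega>. ennreal (f (V \<omega>) * (if W \<omega> > s then 1 else 0)) \<partial>M) =
    (\<integral>\<^sup>+u. ennreal (f u * (survival (F u) s * g u)) \<partial>lborel)" .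
  show "(\<integral>\<omega>. f (V \<omega>) * (if W \<omega> > s then 1 else 0) \<partial>M)
       = (LINT v|lborel. f v * (survival (F v) s * g v))"
    using f g by (subst (1 2) integral_eq_nn_integral) (auto simp: nn surv)
qed

text \<open>
A continuous distribution function takes the value \<open>1 - p\<close>, and it does so at the infimum of the closed
superlevel set. This turns the effective sample size \<open>n * h * survival (F x) (u n)\<close> into exactly \<open>k n * h\<close>.
\<close>

lemma survival_gen_inverse:
  assumes "real_distribution N" "continuous_on UNIV (cdf N)" "0 < p" "p < 1"
  shows "survival (cdf N) (gen_inverse (cdf N) (1 - p)) = p"
proof -
  interpret real_distribution N by fact
  let ?G = "cdf N" and ?q = "1 - p"
  let ?A = "{y. ?q \<le> ?G y}"
  have "\<forall>\<^sub>F y in at_top. ?q < ?G y" using cdf_lim_at_top_prob assms by (intro order_tendstoD) auto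
  then obtain b where b: "?q < ?G b" by (auto simp: eventually_at_top_linorder)
  have "\<forall>\<^sub>F y in at_bot. ?G y < ?q" using cdf_lim_at_bot assms by (intro order_tendstoD) auto
  then obtain a where a: "?G a < ?q" by (auto simp: eventually_at_bot_linorder)
  have ay: "a \<le> y" if "y \<in> ?A" for y using that a cdf_nondecreasing[of y a] by (cases "a \<le> y") auto
  have "closed ?A" by (intro closed_Collect_le continuous_intros assms(2))
  moreover have "b \<in> ?A" using b by simp
  hence "?A \<noteq> {}" by blast
  ultimately have "Inf ?A \<in> ?A" using ay by (intro closed_contains_Inf) (auto simp: bdd_below_def)
  moreover have "\<exists>y. a \<le> y \<and> y \<le> b \<and> ?G y = ?q"
    using a b ay[of b] continuous_on_subset[OF assms(2)] by (intro IVT') auto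
  then obtain y where y: "?G y = ?q" by auto
  have "Inf ?A \<le> y" using y ay by (intro cInf_lower) (auto simp: bdd_below_def)
  hence "?G (Inf ?A) \<le> ?q" using cdf_nondecreasing[of "Inf ?A" y] y by simp
  ultimately have "?G (Inf ?A) = ?q" by simp
  thus ?thesis by (simp add: survival_def gen_inverse_def)
qed

section \<open>Second moments under strong mixing\<close>

lemma strictly_stationary_integral:
  fixes \<phi> :: "(int \<Rightarrow> real \<times> real) \<Rightarrow> real"
  assumes "strictly_stationary M Z" and [measurable]: "\<And>j. Z j \<in> borel_measurable M"
    and "finite J" and [measurable]: "\<phi> \<in> borel_measurable (\<Pi>\<^sub>M j\<in>J. borel)"
  shows "(\<integral>\<omega>. \<phi> (\<lambda>j\<in>J. Z (j + m) \<omega>) \<partial>M) = (\<integral>\<omega>. \<phi> (\<lambda>j\<in>J. Z j \<omega>) \<partial>M)"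
proof -
  have "(\<integral>\<omega>. \<phi> (\<lambda>j\<in>J. Z (j + m) \<omega>) \<partial>M) = integral\<^sup>L (distr M (\<Pi>\<^sub>M j\<in>J. borel) (\<lambda>\<omega>. \<lambda>j\<in>J. Z (j + m) \<omega>)) \<phi>"
    by (subst integral_distr) auto
  also have "\<dots> = integral\<^sup>L (distr M (\<Pi>\<^sub>M j\<in>J. borel) (\<lambda>\<omega>. \<lambda>j\<in>J. Z j \<omega>)) \<phi>"
    using assms(1,3) by (simp add: strictly_stationary_def)
  also have "\<dots> = (\<integral>\<omega>. \<phi> (\<lambda>j\<in>J. Z j \<omega>) \<partial>M)"
    by (subst integral_distr) auto
  finally show ?thesis .
qed

lemma strictly_stationary_marginal:
  assumes "strictly_stationary M Z" "\<And>j. Z j \<in> borel_measurable M"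
    and [measurable]: "f \<in> borel_measurable borel"
  shows "(\<integral>\<omega>. (f (Z j \<omega>) :: real) \<partial>M) = (\<integral>\<omega>. f (Z 0 \<omega>) \<partial>M)"
  using strictly_stationary_integral[OF assms(1,2), of "{0}" "\<lambda>z. f (z 0)" j] by simp

lemma strictly_stationary_lag:
  assumes "strictly_stationary M Z" "\<And>j. Z j \<in> borel_measurable M"
    and [measurable]: "f \<in> borel_measurable borel"
  shows "(\<integral>\<omega>. (f (Z i \<omega>) * f (Z j \<omega>) :: real) \<partial>M) = (\<integral>\<omega>. f (Z 0 \<omega>) * f (Z (j - i) \<omega>) \<partial>M)"
proof -
  have [measurable]: "(\<lambda>z. f (z 0) * f (z (j - i))) \<in> borel_measurable (\<Pi>\<^sub>M _\<in>{0, j - i}. borel)"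
    by measurable
  show ?thesis
    using strictly_stationary_integral[OF assms(1,2), of "{0, j - i}" "\<lambda>z. f (z 0) * f (z (j - i))" i] by simp
qed

text \<open>
Writing \<open>f\<close> as the integral over \<open>s \<in> {0..C}\<close> of the indicators of \<open>s < f\<close> and exchanging the
integrals reduces a bound for \<open>f\<close> to bounds for events.
\<close>

lemma layer_cake_bound:
  fixes f \<Phi> :: "'a \<Rightarrow> real"
  assumes "prob_space M" and [measurable]: "f \<in> borel_measurable M" "\<Phi> \<in> borel_measurable M"
    and f: "\<And>\<omega>. 0 \<le> f \<omega>" "\<And>\<omega>. f \<omega> \<le> C" and \<Phi>: "\<And>\<omega>. \<bar>\<Phi> \<omega>\<bar> \<le> B"
    and a: "\<And>s. \<bar>\<integral>\<omega>. (if s < f \<omega> then \<Phi> \<omega> else 0) \<partial>M\<bar> \<le> a"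
  shows "\<bar>\<integral>\<omega>. f \<omega> * \<Phi> \<omega> \<partial>M\<bar> \<le> C * a"
proof -
  interpret prob_space M by fact
  obtain \<omega>0 where "\<omega>0 \<in> space M" using not_empty by auto
  have C: "C \<ge> 0" using f[of \<omega>0] by linarith
  let ?N = "restrict_space lborel {0..C}"
  have fin: "finite_measure ?N" 
    using C by (intro finite_measureI) (simp add: emeasure_restrict_space space_restrict_space)
  interpret N: finite_measure ?N by fact
  interpret P: pair_sigma_finite M ?N ..
  interpret PF: finite_measure "M \<Otimes>\<^sub>M ?N" by (rule finite_measure_pair_measure) unfold_locales
  have [measurable]: "(\<lambda>s. s) \<in> borel_measurable ?N" by (rule measurable_restrict_space1) simp
  have inner: "(\<integral>s. (if s < f \<omega> then \<Phi> \<omega> else 0) \<partial>?N) = f \<omega> * \<Phi> \<omega>" for \<omega>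
  proof -
    have "(\<integral>s. (if s < f \<omega> then \<Phi> \<omega> else 0) \<partial>?N) = (\<integral>s. indicator {0..C} s *\<^sub>R (if s < f \<omega> then \<Phi> \<omega> else 0) \<partial>lborel)"
      by (subst integral_restrict_space) auto
    also have "\<dots> = (\<integral>s. indicator {0..<f \<omega>} s * \<Phi> \<omega> \<partial>lborel)"
      using f[of \<omega>] by (intro Bochner_Integration.integral_cong) (auto split: split_indicator)
    also have "\<dots> = f \<omega> * \<Phi> \<omega>" using f[of \<omega>] by simp
    finally show ?thesis .
  qed
  have int: "integrable (M \<Otimes>\<^sub>M ?N) (\<lambda>(\<omega>, s). if s < f \<omega> then \<Phi> \<omega> else 0)"
  proof (rule PF.integrable_const_bound[where B = "\<bar>B\<bar>"])
    show "AE z in M \<Otimes>\<^sub>M ?N. norm (case z of (\<omega>, s) \<Rightarrow> if s < f \<omega> then \<Phi> \<omega> else 0) \<le> \<bar>B\<bar>"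
      using order.trans[OF \<Phi> abs_ge_self] by (intro AE_I2) auto
  qed measurable
  have "(\<integral>\<omega>. f \<omega> * \<Phi> \<omega> \<partial>M) = (\<integral>\<omega>. (\<integral>s. (if s < f \<omega> then \<Phi> \<omega> else 0) \<partial>?N) \<partial>M)"
    by (simp add: inner)
  also have "\<dots> = (\<integral>s. (\<integral>\<omega>. (if s < f \<omega> then \<Phi> \<omega> else 0) \<partial>M) \<partial>?N)"
    using P.Fubini_integral[OF int] by simp
  also have "\<bar>\<dots>\<bar> \<le> (\<integral>s. a \<partial>?N)"
  proof (rule order.trans[OF integral_abs_bound integral_mono])
    show "integrable ?N (\<lambda>s. \<bar>\<integral>\<omega>. (if s < f \<omega> then \<Phi> \<omega> else 0) \<partial>M\<bar>)"
      using P.integrable_snd[OF int] by simp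
  qed (use a in auto)
  also have "\<dots> = C * a" using C by (simp add: measure_restrict_space space_restrict_space)
  finally show ?thesis .
qed

text \<open>
The covariance is the integral of \<open>f * (g - \<mu>)\<close> with \<open>\<mu>\<close> the mean of \<open>g\<close>. The layer-cake bound is used
twice: first it replaces \<open>f\<close> by the indicator of an event \<open>A\<close>, which turns the integrand into
\<open>g\<close> times the centred indicator of \<open>A\<close>, and then it replaces \<open>g\<close> by an indicator as well.
\<close>

lemma covariance_inequality:
  fixes f g :: "'a \<Rightarrow> real"
  assumes "prob_space M" and [measurable]: "f \<in> borel_measurable M" "g \<in> borel_measurable M"
    and f: "\<And>\<omega>. 0 \<le> f \<omega>" "\<And>\<omega>. f \<omega> \<le> C" and g: "\<And>\<omega>. 0 \<le> g \<omega>" "\<And>\<omega>. g \<omega> \<le> C"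
    and a: "\<And>s t. \<bar>measure M ({\<omega>\<in>space M. s < f \<omega>} \<inter> {\<omega>\<in>space M. t < g \<omega>})
       - measure M {\<omega>\<in>space M. s < f \<omega>} * measure M {\<omega>\<in>space M. t < g \<omega>}\<bar> \<le> a"
  shows "\<bar>(\<integral>\<omega>. f \<omega> * g \<omega> \<partial>M) - (\<integral>\<omega>. f \<omega> \<partial>M) * (\<integral>\<omega>. g \<omega> \<partial>M)\<bar> \<le> C\<^sup>2 * a"
proof -
  interpret prob_space M by fact
  obtain \<omega>0 where "\<omega>0 \<in> space M" using not_empty by auto
  have C: "C \<ge> 0" using f[of \<omega>0] by linarith
  define \<mu> where "\<mu> = (\<integral>\<omega>. g \<omega> \<partial>M)"
  have fi: "integrable M f" "integrable M g" "integrable M (\<lambda>\<omega>. f \<omega> * g \<omega>)"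
  proof -
    show "integrable M f" "integrable M g" using f g by (auto intro!: integrable_const_bound[of _ C])
    have "f \<omega> * g \<omega> \<le> C * C" for \<omega> by (intro mult_mono f g C)
    thus "integrable M (\<lambda>\<omega>. f \<omega> * g \<omega>)"
      using f(1) g(1) by (auto intro!: integrable_const_bound[of _ "C * C"] simp: abs_mult)
  qed
  have fA: "integrable M (indicat_real A)" "integrable M (\<lambda>\<omega>. indicator A \<omega> * g \<omega>)" "integrable M (\<lambda>\<omega>. g \<omega> * indicator A \<omega>)"
    if "A \<in> sets M" for A
    using that integrable_real_mult_indicator[OF that fi(2)] by (auto simp: emeasure_eq_measure mult.commute)
  have mu: "0 \<le> \<mu>" "\<mu> \<le> C"
    using g fi integral_mono[of M g "\<lambda>_. C"] by (auto simp: \<mu>_def prob_space)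
  have "\<bar>\<integral>\<omega>. f \<omega> * (g \<omega> - \<mu>) \<partial>M\<bar> \<le> C * (C * a)"
  proof (rule layer_cake_bound[OF assms(1) _ _ f, where B = C])
    fix \<omega> show "\<bar>g \<omega> - \<mu>\<bar> \<le> C" using g[of \<omega>] mu by linarith
  next
    fix s
    let ?A = "{\<omega>\<in>space M. s < f \<omega>}"
    have "(\<integral>\<omega>. (if s < f \<omega> then g \<omega> - \<mu> else 0) \<partial>M) = (\<integral>\<omega>. indicator ?A \<omega> * g \<omega> - indicator ?A \<omega> * \<mu> \<partial>M)"
      by (intro Bochner_Integration.integral_cong) auto
    also have "\<dots> = (\<integral>\<omega>. indicator ?A \<omega> * g \<omega> \<partial>M) - measure M ?A * \<mu>"
      using fA[of ?A] by (subst Bochner_Integration.integral_diff) auto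
    also have "\<dots> = (\<integral>\<omega>. g \<omega> * (indicator ?A \<omega> - measure M ?A) \<partial>M)"
      using fi unfolding \<mu>_def right_diff_distrib
      using fA[of ?A] by (subst Bochner_Integration.integral_diff) (auto simp: mult.commute)
    also have "\<bar>\<dots>\<bar> \<le> C * a"
    proof (rule layer_cake_bound[OF assms(1) _ _ g, where B = 1])
      fix \<omega> show "\<bar>indicator ?A \<omega> - measure M ?A\<bar> \<le> 1"
        using prob_le_1[of ?A] measure_nonneg[of M ?A] by (auto split: split_indicator)
    next
      fix t
      let ?B = "{\<omega>\<in>space M. t < g \<omega>}"
      have "(\<integral>\<omega>. (if t < g \<omega> then indicator ?A \<omega> - measure M ?A else 0) \<partial>M)
         = (\<integral>\<omega>. indicator (?A \<inter> ?B) \<omega> - indicator ?B \<omega> * measure M ?A \<partial>M)"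
        by (intro Bochner_Integration.integral_cong) (auto split: split_indicator)
      also have "\<dots> = measure M (?A \<inter> ?B) - measure M ?A * measure M ?B"
        by (subst Bochner_Integration.integral_diff) (auto simp: emeasure_eq_measure)
      finally show "\<bar>\<integral>\<omega>. (if t < g \<omega> then indicator ?A \<omega> - measure M ?A else 0) \<partial>M\<bar> \<le> a" using a[of s t] by simp
    qed measurable
    finally show "\<bar>\<integral>\<omega>. (if s < f \<omega> then g \<omega> - \<mu> else 0) \<partial>M\<bar> \<le> C * a" .
  qed measurable
  moreover have "(\<integral>\<omega>. f \<omega> * (g \<omega> - \<mu>) \<partial>M) = (\<integral>\<omega>. f \<omega> * g \<omega> \<partial>M) - (\<integral>\<omega>. f \<omega> \<partial>M) * \<mu>"
    using fi by (simp add: right_diff_distrib)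
  ultimately show ?thesis by (simp add: \<mu>_def power2_eq_square mult.assoc)
qed

lemma alpha_coeff_bound:
  assumes "prob_space M" "A \<in> sigma_gen_by M Z {..0}" "B \<in> sigma_gen_by M Z {int n..}"
  shows "\<bar>measure M (A \<inter> B) - measure M A * measure M B\<bar> \<le> alpha_coeff M Z n"
proof -
  interpret prob_space M by fact
  have *: "\<bar>measure M (A \<inter> B) - measure M A * measure M B\<bar> \<le> 1" for A B
  proof -
    have "0 \<le> measure M A * measure M B" by simp
    moreover have "measure M A * measure M B \<le> 1" by (intro mult_le_one) auto
    ultimately show ?thesis using prob_le_1[of "A \<inter> B"] measure_nonneg[of M "A \<inter> B"] by linarith
  qed
  show ?thesis unfolding alpha_coeff_def
    by (rule cSup_upper) (use assms * in \<open>auto intro!: bdd_aboveI[of _ 1]\<close>)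
qed

text \<open>
By stationarity only the lag matters, so the earlier of the two variables may be placed at time \<open>0\<close> and
the later one at the lag. These are the positions in which \<open>alpha_coeff\<close> compares events. Lag \<open>0\<close> is
included, as both \<open>\<sigma>\<close>-algebras in \<open>alpha_coeff M Z 0\<close> contain the events of time \<open>0\<close>.
\<close>

lemma stationary_covariance_bound:
  assumes "prob_space M" "strictly_stationary M Z" and Z: "\<And>j. Z j \<in> borel_measurable M"
    and [measurable]: "f \<in> borel_measurable borel" and f: "\<And>z. 0 \<le> f z" "\<And>z. f z \<le> C"
  shows "\<bar>(\<integral>\<omega>. f (Z i \<omega>) * f (Z j \<omega>) \<partial>M) - (\<integral>\<omega>. f (Z 0 \<omega>) \<partial>M)\<^sup>2\<bar> \<le> C\<^sup>2 * alpha_coeff M Z (nat \<bar>i - j\<bar>)"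
proof -
  note [measurable] = Z
  have gen: "{\<omega> \<in> space M. s < f (Z j \<omega>)} \<in> sigma_gen_by M Z I" if "j \<in> I" for s j I
  proof -
    have "{\<omega> \<in> space M. s < f (Z j \<omega>)} = Z j -` {z. s < f z} \<inter> space M" by auto
    moreover have "{z. s < f z} \<in> sets borel" by measurable
    ultimately have "{\<omega> \<in> space M. s < f (Z j \<omega>)} \<in> {Z j -` S \<inter> space M | j S. j \<in> I \<and> S \<in> sets borel}"
      using that by blast
    thus ?thesis unfolding sigma_gen_by_def by (rule sigma_sets.Basic)
  qed
  have main: "\<bar>(\<integral>\<omega>. f (Z i \<omega>) * f (Z j \<omega>) \<partial>M) - (\<integral>\<omega>. f (Z 0 \<omega>) \<partial>M)\<^sup>2\<bar> \<le> C\<^sup>2 * alpha_coeff M Z (nat (j - i))"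
    if "i \<le> j" for i j
  proof -
    have "\<bar>(\<integral>\<omega>. f (Z 0 \<omega>) * f (Z (j - i) \<omega>) \<partial>M) - (\<integral>\<omega>. f (Z 0 \<omega>) \<partial>M) * (\<integral>\<omega>. f (Z (j - i) \<omega>) \<partial>M)\<bar>
        \<le> C\<^sup>2 * alpha_coeff M Z (nat (j - i))"
      using that by (intro covariance_inequality assms(1) f alpha_coeff_bound gen) auto
    thus ?thesis
      using strictly_stationary_lag[OF assms(2) Z, of f i j] strictly_stationary_marginal[OF assms(2) Z, of f "j - i"]
      by (simp add: power2_eq_square)
  qed
  show ?thesis
  proof (cases "i \<le> j")
    case True
    hence "nat \<bar>i - j\<bar> = nat (j - i)" by simp
    thus ?thesis using main[OF True] by simp
  next
    case False
    hence "nat \<bar>i - j\<bar> = nat (i - j)" by simp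
    thus ?thesis using main[of j i] False by (simp add: mult.commute)
  qed
qed

text \<open>
For a fixed first index every lag occurs at most twice, once in the past and once in the future.
\<close>

lemma sum_lags_le:
  fixes c :: "nat \<Rightarrow> real"
  assumes c: "summable c" "\<And>n. 0 \<le> c n"
  shows "(\<Sum>i=1..n. \<Sum>j=1..n. c (nat \<bar>int i - int j\<bar>)) \<le> real n * (2 * suminf c)"
proof -
  have "(\<Sum>j=1..n. c (nat \<bar>int i - int j\<bar>)) \<le> 2 * suminf c" if "i \<in> {1..n}" for i
  proof -
    have "(\<Sum>j=1..n. c (nat \<bar>int i - int j\<bar>)) = (\<Sum>j\<in>{1..i}\<union>{i<..n}. c (nat \<bar>int i - int j\<bar>))"
      using that by (intro sum.cong) auto
    also have "\<dots> = (\<Sum>j=1..i. c (nat \<bar>int i - int j\<bar>)) + (\<Sum>j\<in>{i<..n}. c (nat \<bar>int i - int j\<bar>))"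
      by (intro sum.union_disjoint) auto
    also have "(\<Sum>j=1..i. c (nat \<bar>int i - int j\<bar>)) = sum c ((\<lambda>j. i - j) ` {1..i})"
      by (subst sum.reindex) (auto intro!: inj_onI sum.cong arg_cong[of _ _ c])
    also have "(\<Sum>j\<in>{i<..n}. c (nat \<bar>int i - int j\<bar>)) = sum c ((\<lambda>j. j - i) ` {i<..n})"
      by (subst sum.reindex) (auto intro!: inj_onI sum.cong arg_cong[of _ _ c])
    also have "sum c ((\<lambda>j. i - j) ` {1..i}) + sum c ((\<lambda>j. j - i) ` {i<..n}) \<le> suminf c + suminf c"
      using c by (intro add_mono sum_le_suminf) auto
    finally show ?thesis by simp
  qed
  hence "(\<Sum>i=1..n. \<Sum>j=1..n. c (nat \<bar>int i - int j\<bar>)) \<le> (\<Sum>i=1..n. 2 * suminf c)" by (rule sum_mono)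
  thus ?thesis by simp
qed

lemma stationary_sum_second_moment:
  assumes "prob_space M" "strictly_stationary M Z" and Z: "\<And>j. Z j \<in> borel_measurable M"
    and [measurable]: "f \<in> borel_measurable borel" and f: "\<And>z. 0 \<le> f z" "\<And>z. f z \<le> C"
    and sm: "summable (alpha_coeff M Z)"
  shows "(\<integral>\<omega>. (\<Sum>j=1..n. f (Z (int j) \<omega>) - (\<integral>\<omega>. f (Z 0 \<omega>) \<partial>M))\<^sup>2 \<partial>M) \<le> real n * (2 * C\<^sup>2 * (\<Sum>j. alpha_coeff M Z j))"
proof -
  interpret prob_space M by fact
  note [measurable] = Z
  have C: "C \<ge> 0" using f[of "(0,0)"] by linarith
  define \<mu> where "\<mu> = (\<integral>\<omega>. f (Z 0 \<omega>) \<partial>M)"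
  have nonneg: "0 \<le> alpha_coeff M Z j" for j
    using alpha_coeff_bound[OF assms(1), of "{}" Z "{}" j] by (simp add: sigma_gen_by_def sigma_sets.Empty)
  have i1: "integrable M (\<lambda>\<omega>. f (Z j \<omega>))" for j
    using f by (intro integrable_const_bound[of _ C]) auto
  have i2: "integrable M (\<lambda>\<omega>. f (Z i \<omega>) * f (Z j \<omega>))" for i j
  proof (rule integrable_const_bound[of _ "C * C"])
    have "f (Z i \<omega>) * f (Z j \<omega>) \<le> C * C" for \<omega> by (intro mult_mono f C)
    thus "AE \<omega> in M. norm (f (Z i \<omega>) * f (Z j \<omega>)) \<le> C * C" using f(1) by (simp add: abs_mult)
  qed measurable
  have m: "(\<integral>\<omega>. f (Z j \<omega>) \<partial>M) = \<mu>" for j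
    using strictly_stationary_marginal[OF assms(2) Z, of f j] by (simp add: \<mu>_def)
  have ii: "integrable M (\<lambda>\<omega>. (f (Z i \<omega>) - \<mu>) * (f (Z j \<omega>) - \<mu>))" for i j
    using i1 i2 by (simp add: algebra_simps)
  have cov: "(\<integral>\<omega>. (f (Z i \<omega>) - \<mu>) * (f (Z j \<omega>) - \<mu>) \<partial>M) \<le> C\<^sup>2 * alpha_coeff M Z (nat \<bar>i - j\<bar>)" for i j
  proof -
    have "(\<integral>\<omega>. (f (Z i \<omega>) - \<mu>) * (f (Z j \<omega>) - \<mu>) \<partial>M)
        = (\<integral>\<omega>. f (Z i \<omega>) * f (Z j \<omega>) - \<mu> * f (Z i \<omega>) - \<mu> * f (Z j \<omega>) + \<mu>\<^sup>2 \<partial>M)"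
      by (simp add: algebra_simps power2_eq_square)
    also have "\<dots> = (\<integral>\<omega>. f (Z i \<omega>) * f (Z j \<omega>) \<partial>M) - \<mu>\<^sup>2"
      using i1 i2 by (simp add: m prob_space power2_eq_square)
    finally show ?thesis
      using stationary_covariance_bound[OF assms(1-4) f, of i j] by (simp add: \<mu>_def)
  qed
  have "(\<integral>\<omega>. (\<Sum>j=1..n. f (Z (int j) \<omega>) - \<mu>)\<^sup>2 \<partial>M)
     = (\<Sum>i=1..n. \<Sum>j=1..n. \<integral>\<omega>. (f (Z (int i) \<omega>) - \<mu>) * (f (Z (int j) \<omega>) - \<mu>) \<partial>M)"
    using ii by (simp add: power2_eq_square sum_product Bochner_Integration.integral_sum)
  also have "\<dots> \<le> (\<Sum>i=1..n. \<Sum>j=1..n. C\<^sup>2 * alpha_coeff M Z (nat \<bar>int i - int j\<bar>))"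
    by (intro sum_mono cov)
  also have "\<dots> = C\<^sup>2 * (\<Sum>i=1..n. \<Sum>j=1..n. alpha_coeff M Z (nat \<bar>int i - int j\<bar>))"
    by (simp add: sum_distrib_left)
  also have "\<dots> \<le> C\<^sup>2 * (real n * (2 * suminf (alpha_coeff M Z)))"
    by (intro mult_left_mono sum_lags_le sm nonneg) auto
  finally show ?thesis by (simp add: \<mu>_def algebra_simps)
qed

section \<open>Mean and mean squared error of the estimators\<close>

lemma V_tilde_mean:
  fixes X Y :: "int \<Rightarrow> 'a \<Rightarrow> real"
  assumes "prob_space M" and [measurable]: "\<And>j. X j \<in> borel_measurable M" "\<And>j. Y j \<in> borel_measurable M"
    and st: "strictly_stationary M (\<lambda>j \<omega>. (X j \<omega>, Y j \<omega>))"
    and "\<And>u. 0 \<le> g u" "distributed M lborel (X 0) (\<lambda>u. ennreal (g u))" "conditional_cdf M (X 0) (Y 0) F"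
    and K: "kernel_density K" and "n \<ge> 1"
  shows "(\<integral>\<omega>. V_tilde X Y K F x h u n t \<omega> \<partial>M)
     = (LINT v|lborel. K ((x - v) / h) * (survival (F v) (t * u) / survival (F x) u * g v)) / h"
proof -
  interpret prob_space M by fact
  have [measurable]: "K \<in> borel_measurable borel" and K0: "\<And>t. 0 \<le> K t" using K by (auto simp: kernel_density_def)
  have "bounded (range K)" using K by (simp add: kernel_density_def)
  then obtain B where "\<forall>z\<in>range K. norm z \<le> B" unfolding bounded_iff by blast
  hence B: "norm (K t) \<le> B" for t by blast
  define f where "f = (\<lambda>z. K ((x - fst z) / h) * (if snd z > t * u then 1 else (0::real)))"
  have [measurable]: "f \<in> borel_measurable borel" unfolding f_def borel_prod[symmetric] by measurable
  have f: "norm (f z) \<le> B" for z using B[of "(x - fst z)/h"] order.trans[OF norm_ge_zero B] by (simp add: f_def)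
  have int: "integrable M (\<lambda>\<omega>. f (X j \<omega>, Y j \<omega>))" for j
    using f by (intro integrable_const_bound[of _ B]) (auto simp: borel_prod[symmetric])
  have m: "(\<integral>\<omega>. f (X j \<omega>, Y j \<omega>) \<partial>M) = (\<integral>\<omega>. f (X 0 \<omega>, Y 0 \<omega>) \<partial>M)" for j
    by (rule strictly_stationary_marginal[OF st, of f]) measurable
  have "(\<integral>\<omega>. V_tilde X Y K F x h u n t \<omega> \<partial>M)
      = (\<integral>\<omega>. 1 / (real n * h * survival (F x) u) * (\<Sum>j=1..n. f (X (int j) \<omega>, Y (int j) \<omega>)) \<partial>M)"
    by (simp add: V_tilde_def f_def)
  also have "\<dots> = 1 / (real n * h * survival (F x) u) * (real n * (\<integral>\<omega>. f (X 0 \<omega>, Y 0 \<omega>) \<partial>M))"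
  proof -
    have "(\<integral>\<omega>. (\<Sum>j=1..n. f (X (int j) \<omega>, Y (int j) \<omega>)) \<partial>M) = (\<Sum>j=1..n. \<integral>\<omega>. f (X (int j) \<omega>, Y (int j) \<omega>) \<partial>M)"
      by (rule Bochner_Integration.integral_sum) (rule int)
    also have "\<dots> = (\<Sum>j=1..n. \<integral>\<omega>. f (X 0 \<omega>, Y 0 \<omega>) \<partial>M)" by (rule sum.cong[OF refl m])
    also have "\<dots> = real n * (\<integral>\<omega>. f (X 0 \<omega>, Y 0 \<omega>) \<partial>M)" by simp
    finally show ?thesis by (simp only: integral_mult_right_zero)
  qed
  also have "\<dots> = (\<integral>\<omega>. f (X 0 \<omega>, Y 0 \<omega>) \<partial>M) / survival (F x) u / h"
    using \<open>n \<ge> 1\<close> by simp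
  also have "\<dots> = (LINT v|lborel. K ((x - v) / h) * (survival (F v) (t * u) / survival (F x) u * g v)) / h"
  proof -
    have "(\<integral>\<omega>. f (X 0 \<omega>, Y 0 \<omega>) \<partial>M) = (LINT v|lborel. K ((x - v) / h) * (survival (F v) (t * u) * g v))"
      unfolding f_def fst_conv snd_conv
      by (rule conditional_tail_expectation(2)[OF assms(1-3,6,5,7), of "\<lambda>v. K ((x - v)/h)" "t * u"]) (auto simp: K0)
    moreover have "(LINT v|lborel. K ((x - v) / h) * (survival (F v) (t * u) / survival (F x) u * g v))
        = (LINT v|lborel. K ((x - v) / h) * (survival (F v) (t * u) * g v)) / survival (F x) u"
      by (simp flip: integral_divide_zero)
    ultimately show ?thesis by simp
  qed
  finally show ?thesis .
qed

lemma V_bias_measurable: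
  fixes X Y :: "int \<Rightarrow> 'a \<Rightarrow> real"
  assumes "prob_space M" and [measurable]: "\<And>j. X j \<in> borel_measurable M" "\<And>j. Y j \<in> borel_measurable M"
    and [measurable]: "K \<in> borel_measurable borel"
  shows "(\<lambda>t. V_bias M X Y K F \<gamma> g x h u n t) \<in> borel_measurable borel"
proof -
  interpret prob_space M by fact
  show ?thesis unfolding V_bias_def V_tilde_def by measurable
qed

text \<open>
The two terms are variance and squared bias. Covariances are bounded by mixing alone, without the gain
that local smoothing would offer, so the variance is of order \<open>1 / (n * h\<^sup>2)\<close> instead of the optimal
\<open>1 / (n * h)\<close>. This is harmless for bandwidths decaying more slowly than \<open>n powr (-1/2)\<close>.
\<close>

lemma dens_est_mse:
  fixes X Y :: "int \<Rightarrow> 'a \<Rightarrow> real"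
  assumes "prob_space M" and [measurable]: "\<And>j. X j \<in> borel_measurable M" "\<And>j. Y j \<in> borel_measurable M"
    and st: "strictly_stationary M (\<lambda>j \<omega>. (X j \<omega>, Y j \<omega>))"
    and g: "\<And>u. 0 \<le> g u" and dis: "distributed M lborel (X 0) (\<lambda>u. ennreal (g u))"
    and K: "kernel_density K" and B: "\<And>t. K t \<le> B" and h: "h > 0" and n: "n \<ge> 1"
    and sm: "summable (alpha_coeff M (\<lambda>j \<omega>. (X j \<omega>, Y j \<omega>)))"
    and b: "\<And>v. \<bar>v - x\<bar> \<le> h \<Longrightarrow> \<bar>g v - g x\<bar> \<le> b"
  shows "integrable M (\<lambda>\<omega>. (g x - dens_est X K x h n \<omega>)\<^sup>2)"
    and "(\<integral>\<omega>. (g x - dens_est X K x h n \<omega>)\<^sup>2 \<partial>M)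
       \<le> 4 * B\<^sup>2 * (\<Sum>j. alpha_coeff M (\<lambda>j \<omega>. (X j \<omega>, Y j \<omega>)) j) / (real n * h\<^sup>2) + 2 * b\<^sup>2"
proof -
  interpret prob_space M by fact
  let ?Z = "\<lambda>j \<omega>. (X j \<omega>, Y j \<omega>)"
  have [measurable]: "K \<in> borel_measurable borel" and K0: "\<And>t. 0 \<le> K t" using K by (auto simp: kernel_density_def)
  have [measurable]: "g \<in> borel_measurable borel"
    using distributed_real_measurable[OF _ dis] g by simp
  define f where "f = (\<lambda>z::real\<times>real. K ((x - fst z) / h))"
  have fm[measurable]: "f \<in> borel_measurable borel" unfolding f_def borel_prod[symmetric] by measurable
  define \<mu> where "\<mu> = (\<integral>\<omega>. f (?Z 0 \<omega>) \<partial>M)"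
  define S where "S = (\<lambda>\<omega>. \<Sum>j=1..n. f (?Z (int j) \<omega>) - \<mu>)"
  have S2: "(\<integral>\<omega>. (S \<omega>)\<^sup>2 \<partial>M) \<le> real n * (2 * B\<^sup>2 * (\<Sum>j. alpha_coeff M ?Z j))"
    unfolding S_def \<mu>_def
    by (rule stationary_sum_second_moment[OF assms(1) st _ fm _ _ sm]) (auto simp: f_def K0 B borel_prod[symmetric])
  have Sm[measurable]: "S \<in> borel_measurable M" unfolding S_def f_def by measurable
  have mu: "\<bar>\<mu> / h - g x\<bar> \<le> b"
  proof -
    have "\<mu> = (LINT v|lborel. K ((x - v) / h) * g v)"
      using distributed_integral[OF dis, of "\<lambda>v. K ((x - v) / h)"] g by (simp add: \<mu>_def f_def mult.commute)
    thus ?thesis using kernel_average_error[OF K h, of g x "g x" b] b by simp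
  qed
  have decomp: "g x - dens_est X K x h n \<omega> = - (S \<omega> / (real n * h)) - (\<mu> / h - g x)" for \<omega>
    using n h by (simp add: dens_est_def S_def f_def sum_subtractf field_simps)
  have dens_bdd: "\<bar>S \<omega>\<bar> \<le> real n * (B + \<bar>\<mu>\<bar>)" for \<omega>
  proof -
    have "\<bar>f z - \<mu>\<bar> \<le> B + \<bar>\<mu>\<bar>" for z
      using K0[of "(x - fst z) / h"] B[of "(x - fst z) / h"] unfolding f_def by linarith
    hence "(\<Sum>j=1..n. \<bar>f (?Z (int j) \<omega>) - \<mu>\<bar>) \<le> (\<Sum>j=1..n. B + \<bar>\<mu>\<bar>)" by (intro sum_mono)
    moreover have "\<bar>S \<omega>\<bar> \<le> (\<Sum>j=1..n. \<bar>f (?Z (int j) \<omega>) - \<mu>\<bar>)" unfolding S_def by (rule sum_abs)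
    ultimately show ?thesis by simp
  qed
  have iS: "integrable M (\<lambda>\<omega>. (S \<omega>)\<^sup>2)" "integrable M S"
  proof -
    show "integrable M S" using dens_bdd by (intro integrable_const_bound[of _ "real n * (B + \<bar>\<mu>\<bar>)"]) auto
    have "(S \<omega>)\<^sup>2 \<le> (real n * (B + \<bar>\<mu>\<bar>))\<^sup>2" for \<omega>
      using power_mono[OF dens_bdd[of \<omega>], where n = 2] by simp
    thus "integrable M (\<lambda>\<omega>. (S \<omega>)\<^sup>2)"
      by (intro integrable_const_bound[of _ "(real n * (B + \<bar>\<mu>\<bar>))\<^sup>2"]) auto
  qed
  show int: "integrable M (\<lambda>\<omega>. (g x - dens_est X K x h n \<omega>)\<^sup>2)"
    unfolding decomp using iS by (simp add: power2_diff power_divide)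
  have "(\<integral>\<omega>. (g x - dens_est X K x h n \<omega>)\<^sup>2 \<partial>M) \<le> (\<integral>\<omega>. 2 / (real n * h)\<^sup>2 * (S \<omega>)\<^sup>2 + 2 * b\<^sup>2 \<partial>M)"
  proof (rule integral_mono[OF int])
    fix \<omega>
    have "(p + q)\<^sup>2 \<le> 2 * p\<^sup>2 + 2 * q\<^sup>2" for p q :: real
      using zero_le_power2[of "p - q"] by (simp add: power2_eq_square algebra_simps)
    from this[of "- (S \<omega> / (real n * h))" "- (\<mu> / h - g x)"]
    have "(g x - dens_est X K x h n \<omega>)\<^sup>2 \<le> 2 * (S \<omega> / (real n * h))\<^sup>2 + 2 * (\<mu> / h - g x)\<^sup>2"
      unfolding decomp by (simp only: diff_conv_add_uminus power2_minus)
    moreover have "(\<mu> / h - g x)\<^sup>2 \<le> b\<^sup>2" using power_mono[OF mu, where n = 2] by simp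
    ultimately show "(g x - dens_est X K x h n \<omega>)\<^sup>2 \<le> 2 / (real n * h)\<^sup>2 * (S \<omega>)\<^sup>2 + 2 * b\<^sup>2"
      by (simp add: power_divide)
  qed (use iS in simp)
  also have "\<dots> = 2 / (real n * h)\<^sup>2 * (\<integral>\<omega>. (S \<omega>)\<^sup>2 \<partial>M) + 2 * b\<^sup>2" using iS by (simp add: prob_space)
  also have "\<dots> \<le> 2 / (real n * h)\<^sup>2 * (real n * (2 * B\<^sup>2 * (\<Sum>j. alpha_coeff M ?Z j))) + 2 * b\<^sup>2"
    using S2 by (intro add_right_mono mult_left_mono) auto
  also have "\<dots> = 4 * B\<^sup>2 * (\<Sum>j. alpha_coeff M ?Z j) / (real n * h\<^sup>2) + 2 * b\<^sup>2"
    using n h by (simp add: field_simps power2_eq_square)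
  finally show "(\<integral>\<omega>. (g x - dens_est X K x h n \<omega>)\<^sup>2 \<partial>M)
       \<le> 4 * B\<^sup>2 * (\<Sum>j. alpha_coeff M ?Z j) / (real n * h\<^sup>2) + 2 * b\<^sup>2" .
qed

lemma second_moment_imp_tendsto_in_prob:
  assumes "prob_space M"
    and W: "\<forall>\<^sub>F n in sequentially. integrable M (\<lambda>\<omega>. (W n \<omega>)\<^sup>2) \<and> (\<integral>\<omega>. (W n \<omega>)\<^sup>2 \<partial>M) \<le> b n"
    and b: "b \<longlonglongrightarrow> 0"
  shows "tendsto_in_prob M W 0"
  unfolding tendsto_in_prob_def
proof (intro allI impI)
  interpret prob_space M by fact
  fix \<epsilon> :: real assume \<epsilon>: "\<epsilon> > 0"
  have "\<forall>\<^sub>F n in sequentially. norm (measure M {\<omega> \<in> space M. \<bar>W n \<omega> - 0\<bar> > \<epsilon>}) \<le> b n / \<epsilon>\<^sup>2"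
    using W
  proof eventually_elim
    case (elim n)
    hence [measurable]: "(\<lambda>\<omega>. (W n \<omega>)\<^sup>2) \<in> borel_measurable M" by auto
    have "measure M {\<omega> \<in> space M. \<bar>W n \<omega> - 0\<bar> > \<epsilon>} \<le> measure M {\<omega> \<in> space M. (W n \<omega>)\<^sup>2 \<ge> \<epsilon>\<^sup>2}"
    proof (rule finite_measure_mono)
      show "{\<omega> \<in> space M. \<bar>W n \<omega> - 0\<bar> > \<epsilon>} \<subseteq> {\<omega> \<in> space M. (W n \<omega>)\<^sup>2 \<ge> \<epsilon>\<^sup>2}"
      proof
        fix \<omega> assume *: "\<omega> \<in> {\<omega> \<in> space M. \<bar>W n \<omega> - 0\<bar> > \<epsilon>}"
        hence "\<epsilon>\<^sup>2 \<le> \<bar>W n \<omega>\<bar>\<^sup>2" using \<epsilon> by (intro power_mono) auto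
        thus "\<omega> \<in> {\<omega> \<in> space M. (W n \<omega>)\<^sup>2 \<ge> \<epsilon>\<^sup>2}" using * by simp
      qed
    qed measurable
    also have "\<dots> \<le> (\<integral>\<omega>. (W n \<omega>)\<^sup>2 \<partial>M) / \<epsilon>\<^sup>2"
      using elim \<epsilon> by (intro integral_Markov_inequality_measure[where A = "{}"]) auto
    also have "\<dots> \<le> b n / \<epsilon>\<^sup>2" using elim by (intro divide_right_mono) auto
    finally show ?case by simp
  qed
  moreover have "(\<lambda>n. b n / \<epsilon>\<^sup>2) \<longlonglongrightarrow> 0" using b by (rule tendsto_divide_zero)
  ultimately show "(\<lambda>n. measure M {\<omega> \<in> space M. \<bar>W n \<omega> - 0\<bar> > \<epsilon>}) \<longlonglongrightarrow> 0"
    by (rule Lim_null_comparison)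
qed

section \<open>Integrals against the logarithmic scale\<close>

lemma power_tail_integral:
  fixes a :: real assumes "a > 0"
  shows "set_integrable lborel {1..} (\<lambda>t. t powr (-a) / t)"
    and "(LINT t:{1..}|lborel. t powr (-a) / t) = 1 / a"
proof -
  have *: "(\<integral>\<^sup>+t. ennreal (t powr (-a) / t) * indicator {1..} t \<partial>lborel) = ennreal (0 - (- (1 powr (-a)) / a))"
  proof (rule nn_integral_FTC_atLeast)
    fix t :: real assume "1 \<le> t"
    thus "((\<lambda>t. - (t powr (-a)) / a) has_real_derivative t powr (-a) / t) (at t)"
      using assms by (auto intro!: derivative_eq_intros simp: field_simps powr_minus powr_diff)
    show "0 \<le> t powr (-a) / t" using \<open>1 \<le> t\<close> by simp
  next
    show "((\<lambda>t. - (t powr (-a)) / a) \<longlongrightarrow> 0) at_top" using assms by real_asymp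
  qed measurable
  have "has_bochner_integral lborel (\<lambda>t. indicator {1..} t *\<^sub>R (t powr (-a) / t)) (1 / a)"
  proof (rule has_bochner_integral_nn_integral)
    have "(\<integral>\<^sup>+t. ennreal (indicator {1..} t *\<^sub>R (t powr (-a) / t)) \<partial>lborel)
        = (\<integral>\<^sup>+t. ennreal (t powr (-a) / t) * indicator {1..} t \<partial>lborel)"
      by (intro nn_integral_cong) (auto split: split_indicator)
    thus "(\<integral>\<^sup>+t. ennreal (indicator {1..} t *\<^sub>R (t powr (-a) / t)) \<partial>lborel) = ennreal (1/a)"
      unfolding * by simp
  qed (use assms in \<open>auto split: split_indicator\<close>)
  thus "set_integrable lborel {1..} (\<lambda>t. t powr (-a) / t)" "(LINT t:{1..}|lborel. t powr (-a) / t) = 1 / a"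
    unfolding set_integrable_def set_lebesgue_integral_def by (auto simp: has_bochner_integral_iff)
qed

lemma log_scale_integral_bound:
  fixes b :: "real \<Rightarrow> real"
  assumes "a > 0" and [measurable]: "b \<in> borel_measurable borel" and b: "\<And>t. t \<ge> 1 \<Longrightarrow> \<bar>b t\<bar> \<le> C * t powr (-a)"
  shows "set_integrable lborel {1..} (\<lambda>t. b t / t)"
    and "\<bar>LINT t:{1..}|lborel. b t / t\<bar> \<le> C / a"
proof -
  have i: "set_integrable lborel {1..} (\<lambda>t. C * (t powr (-a) / t))"
    using power_tail_integral(1)[OF assms(1)] by (rule set_integrable_mult_right)
  have le: "\<bar>b t / t\<bar> \<le> C * (t powr (-a) / t)" if "t \<ge> 1" for t
    using divide_right_mono[OF b[OF that], of t] that by (simp add: abs_divide)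
  show ib: "set_integrable lborel {1..} (\<lambda>t. b t / t)"
  proof (rule set_integrable_bound[OF i])
    show "AE t in lborel. t \<in> {1..} \<longrightarrow> norm (b t / t) \<le> norm (C * (t powr (-a) / t))"
      using order.trans[OF le abs_ge_self] by (intro AE_I2) auto
  qed (auto simp: set_borel_measurable_def)
  have "\<bar>LINT t:{1..}|lborel. b t / t\<bar> \<le> (LINT t:{1..}|lborel. \<bar>b t / t\<bar>)"
    using ib by (intro set_integral_norm_bound[where 'a=real, simplified])
  also have "\<dots> \<le> (LINT t:{1..}|lborel. C * (t powr (-a) / t))"
    using le ib i by (intro set_integral_mono set_integrable_abs) auto
  also have "\<dots> = C / a"
    by (subst set_integral_mult_right) (simp add: power_tail_integral(2)[OF assms(1)])
  finally show "\<bar>LINT t:{1..}|lborel. b t / t\<bar> \<le> C / a" .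
qed

section \<open>Powers of the sample size and the growth of quantiles\<close>

lemma floor_powr_bounds:
  fixes a :: real
  assumes "0 < a" "n \<ge> 1"
  shows "real n powr a / 2 \<le> real (nat \<lfloor>real n powr a\<rfloor>)" "real (nat \<lfloor>real n powr a\<rfloor>) \<le> real n powr a"
    "1 \<le> real (nat \<lfloor>real n powr a\<rfloor>)"
proof -
  have y: "real n powr a \<ge> 1" using assms by (simp add: ge_one_powr_ge_zero)
  hence "\<lfloor>real n powr a\<rfloor> \<ge> 1" by simp
  hence f: "real (nat \<lfloor>real n powr a\<rfloor>) = of_int \<lfloor>real n powr a\<rfloor>" "real_of_int \<lfloor>real n powr a\<rfloor> \<ge> 1" by auto
  show "real (nat \<lfloor>real n powr a\<rfloor>) \<le> real n powr a" "1 \<le> real (nat \<lfloor>real n powr a\<rfloor>)" using f by auto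
  show "real n powr a / 2 \<le> real (nat \<lfloor>real n powr a\<rfloor>)" using f by linarith
qed

lemma intermediate_floor_powr:
  assumes "0 < a" "a < 1"
  shows "intermediate (\<lambda>n. nat \<lfloor>real n powr a\<rfloor>)"
  unfolding intermediate_def
proof (intro conjI allI)
  fix n :: nat
  show "nat \<lfloor>real n powr a\<rfloor> \<le> n"
  proof (cases "n = 0")
    case False
    hence "real (nat \<lfloor>real n powr a\<rfloor>) \<le> real n powr a" using floor_powr_bounds(2)[OF assms(1), of n] by simp
    also have "\<dots> \<le> real n powr 1" using False assms by (intro powr_mono) auto
    finally show ?thesis by simp
  qed simp
next
  have "filterlim (\<lambda>n. real n powr a / 2) at_top sequentially" using assms by real_asymp
  hence "filterlim (\<lambda>n. real (nat \<lfloor>real n powr a\<rfloor>)) at_top sequentially"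
    by (rule filterlim_at_top_mono) (use floor_powr_bounds(1)[OF assms(1)] in \<open>auto simp: eventually_at_top_linorder\<close>)
  thus "filterlim (\<lambda>n. nat \<lfloor>real n powr a\<rfloor>) at_top sequentially"
    by (simp add: filterlim_sequentially_iff_filterlim_real)
next
  have "(\<lambda>n. real n powr a / real n) \<longlonglongrightarrow> 0" using assms by real_asymp
  thus "(\<lambda>n. real (nat \<lfloor>real n powr a\<rfloor>) / real n) \<longlonglongrightarrow> 0"
    by (rule tendsto_sandwich[OF _ _ tendsto_const, rotated 2])
       (use floor_powr_bounds(2)[OF assms(1)] in \<open>auto simp: eventually_at_top_linorder intro!: exI[of _ 1] divide_right_mono\<close>)
qed

text \<open>
Inverting the tail expansion at a level between \<open>1 / n\<close> and \<open>n powr (-3/4)\<close>. Only the order of magnitude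
of \<open>ln (u n)\<close> is required, so the logarithmic factor of the tail is bounded crudely: from below by
\<open>1\<close> and from above by a multiple of \<open>u powr (\<rho>/2)\<close>.
\<close>

lemma quantile_log_growth:
  fixes S :: "real \<Rightarrow> real" and u p :: "nat \<Rightarrow> real"
  assumes "c > 0" "\<zeta> \<ge> \<rho>" "\<rho> > 0"
    and R: "\<And>t. t \<ge> 1 \<Longrightarrow> \<bar>S t - c * ln t * t powr (-\<rho>)\<bar> \<le> A * t powr (-\<zeta>)"
    and u: "filterlim u at_top sequentially"
    and p: "\<forall>\<^sub>F n in sequentially. S (u n) = p n"
      "\<forall>\<^sub>F n in sequentially. 1 / real n \<le> p n" "\<forall>\<^sub>F n in sequentially. p n \<le> real n powr (-3/4)"
  shows "\<forall>\<^sub>F n in sequentially. ln (real n) / (2 * \<rho>) \<le> ln (u n) \<and> ln (u n) \<le> 4 / \<rho> * ln (real n)"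
proof -
  have "\<forall>\<^sub>F n in sequentially. ln (c/2) + 1/4 * ln (real n) \<ge> 0" by real_asymp
  moreover have "\<forall>\<^sub>F n in sequentially. ln (4 * c / \<rho>) \<le> ln (real n)" by real_asymp
  moreover have "\<forall>\<^sub>F n in sequentially. u n \<ge> max (exp 1) (exp (2 * A / c))"
    using u unfolding filterlim_at_top by blast
  ultimately show ?thesis using p eventually_gt_at_top[of 0]
  proof eventually_elim
    case (elim n)
    have un: "u n \<ge> exp 1" "u n \<ge> exp (2 * A / c)" "u n > 0"
      using elim(3) less_le_trans[OF exp_gt_zero[of 1], of "u n"] by auto
    hence lu: "ln (u n) \<ge> 1" "ln (u n) \<ge> 2 * A / c" by (auto simp: ln_ge_iff)
    have u1: "u n \<ge> 1" using un(1) exp_ge_add_one_self[of 1] by linarith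
    note b = log_tail_bounds[OF assms(1,2) R u1 lu(2)]
    have n: "real n > 0" using elim by simp
    have "c/2 * 1 * u n powr (-\<rho>) \<le> c/2 * ln (u n) * u n powr (-\<rho>)"
      using lu \<open>c > 0\<close> by (intro mult_right_mono mult_left_mono) auto
    hence "c/2 * u n powr (-\<rho>) \<le> real n powr (-3/4)" using b(1) elim by simp
    hence "ln (c/2 * u n powr (-\<rho>)) \<le> ln (real n powr (-3/4))" using un \<open>c > 0\<close> by (intro ln_mono) auto
    also have "ln (c/2 * u n powr (-\<rho>)) = ln (c/2) - \<rho> * ln (u n)"
      using un \<open>c > 0\<close> by (subst ln_mult) (auto simp: ln_powr)
    also have "ln (real n powr (-3/4)) = -3/4 * ln (real n)" using n by (simp add: ln_powr)
    finally have "1/2 * ln (real n) \<le> \<rho> * ln (u n)" using elim(1) by linarith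
    hence 1: "ln (real n) / (2 * \<rho>) \<le> ln (u n)" using \<open>\<rho> > 0\<close> by (simp add: field_simps)
    have "ln (u n) \<le> u n powr (\<rho>/2) / (\<rho>/2)" using u1 \<open>\<rho> > 0\<close> by (intro ln_powr_bound) auto
    hence "2 * c * ln (u n) * u n powr (-\<rho>) \<le> 2 * c * (u n powr (\<rho>/2) / (\<rho>/2)) * u n powr (-\<rho>)"
      using \<open>c > 0\<close> by (intro mult_right_mono mult_left_mono) auto
    also have "\<dots> = 4 * c / \<rho> * (u n powr (\<rho>/2) * u n powr (-\<rho>))" by simp
    also have "u n powr (\<rho>/2) * u n powr (-\<rho>) = u n powr (-(\<rho>/2))" by (simp flip: powr_add)
    finally have "1 / real n \<le> 4 * c / \<rho> * u n powr (-(\<rho>/2))" using b(2) elim by simp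
    hence "ln (1 / real n) \<le> ln (4 * c / \<rho> * u n powr (-(\<rho>/2)))" using n by (intro ln_mono) auto
    also have "ln (4 * c / \<rho> * u n powr (-(\<rho>/2))) = ln (4 * c / \<rho>) - \<rho>/2 * ln (u n)"
      using un \<open>c > 0\<close> \<open>\<rho> > 0\<close> by (subst ln_mult) (auto simp: ln_powr)
    finally have "\<rho>/2 * ln (u n) \<le> 2 * ln (real n)" using elim(2) n by (simp add: ln_div)
    hence "ln (u n) \<le> 4 / \<rho> * ln (real n)" using \<open>\<rho> > 0\<close> by (simp add: field_simps)
    with 1 show ?case by simp
  qed
qed

section \<open>Existence of admissible sequences\<close>

theorem theorem9:
  fixes M :: "'a measure"
    and X Y :: "int \<Rightarrow> 'a \<Rightarrow> real"
    and g K \<gamma> :: "real \<Rightarrow> real"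
    and F L :: "real \<Rightarrow> real \<Rightarrow> real"
    and U :: "real set"
    and x \<eta> \<nu> c\<^sub>\<gamma> y\<^sub>0 c\<^sub>L c\<^sub>x \<zeta>\<^sub>x :: real
  defines "Z \<equiv> \<lambda>j \<omega>. (X j \<omega>, Y j \<omega>)"
  assumes "prob_space M"
    and "\<And>j. X j \<in> borel_measurable M"
    and "\<And>j. Y j \<in> borel_measurable M"
    and "\<And>j. AE \<omega> in M. Y j \<omega> > 0"
    and "strictly_stationary M Z"
    and "\<And>u. 0 \<le> g u"
    and "distributed M lborel (X 0) (\<lambda>u. ennreal (g u))"
    and "twice_cont_diff g"
    and "\<And>i j. i \<noteq> j \<Longrightarrow> has_bounded_joint_density M (X i) (X j)"
    and "conditional_cdf M (X 0) (Y 0) F"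
    and "open U" and "x \<in> U" and "g x > 0"
    and "\<And>u. u \<in> U \<Longrightarrow> \<gamma> u > 0"
    and "\<And>u. u \<in> U \<Longrightarrow> slowly_varying (L u)"
    and "\<And>u y. u \<in> U \<Longrightarrow> y > 0 \<Longrightarrow> survival (F u) y = L u y * y powr (- 1 / \<gamma> u)"
    and "kernel_density K"
    and "(\<lambda>n. beta_coeff M Z n) \<longlonglongrightarrow> 0"
    and "\<eta> > 2" and "(\<lambda>j. alpha_coeff M Z j) \<in> O(\<lambda>j. real j powr (- \<eta>))"
    and "\<nu> > 0" and "(\<lambda>j. beta_coeff M Z j) \<in> O(\<lambda>j. real j powr (- \<nu>))"
    and "continuous_on UNIV (F x)"
    and C1: "c\<^sub>\<gamma>-lipschitz_on U (\<lambda>u. 1 / \<gamma> u)"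
    and C3: "y\<^sub>0 > 1" "c\<^sub>L > 0"
      "\<And>u v y. u \<in> U \<Longrightarrow> v \<in> U \<Longrightarrow> y \<ge> y\<^sub>0 \<Longrightarrow>
         \<bar>(ln (L v y) - ln (L u y)) / ln y\<bar> \<le> c\<^sub>L * \<bar>v - u\<bar>"
    and S': "c\<^sub>x > 0" "\<zeta>\<^sub>x * \<gamma> x > 1"
      "bdd_above ((\<lambda>t. t powr \<zeta>\<^sub>x * \<bar>survival (F x) t - c\<^sub>x * ln t * t powr (- 1 / \<gamma> x)\<bar>) ` {1..})"
  shows "\<exists>(k :: nat \<Rightarrow> nat) (h :: nat \<Rightarrow> real) (r :: nat \<Rightarrow> nat) (l :: nat \<Rightarrow> nat) (u :: nat \<Rightarrow> real).
    intermediate k \<and> intermediate r \<and> intermediate l \<and> (\<forall>n. h n > 0) \<and>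
    (\<forall>n. u n = gen_inverse (F x) (1 - real (k n) / real n)) \<and>
    \<comment> \<open>(i)\<close>
    (\<lambda>n. h n * ln (u n)) \<longlonglongrightarrow> 0 \<and>
    \<comment> \<open>(ii)\<close>
    (\<forall>\<^sub>F n in sequentially. real n * h n * survival (F x) (u n) = real (k n) * h n) \<and>
    filterlim (\<lambda>n. real (k n) * h n) at_top sequentially \<and>
    \<comment> \<open>(iii)\<close>
    (\<forall>\<^sub>F n in sequentially.
       real (r n) * h n * survival (F x) (u n) = real (r n) * h n * real (k n) / real n) \<and>
    (\<lambda>n. real (r n) * h n * real (k n) / real n) \<longlonglongrightarrow> 0 \<and>
    \<comment> \<open>(iv)\<close>
    (\<lambda>n. 1 / real (l n)) \<longlonglongrightarrow> 0 \<and>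
    (\<lambda>n. real (l n) / real (r n)) \<longlonglongrightarrow> 0 \<and>
    (\<lambda>n. real (r n) / real n) \<longlonglongrightarrow> 0 \<and>
    (\<lambda>n. real n / real (r n) * beta_coeff M Z (l n)) \<longlonglongrightarrow> 0 \<and>
    \<comment> \<open>(v)\<close>
    tendsto_in_prob M (\<lambda>n \<omega>. sqrt (real (k n) * h n) * (g x - dens_est X K x (h n) n \<omega>)) 0 \<and>
    \<comment> \<open>(vi)\<close>
    (\<exists>s\<^sub>0. 0 < s\<^sub>0 \<and> s\<^sub>0 < 1 \<and>
       (\<lambda>n. sqrt (real (k n) * h n) * B_sup M X Y K F \<gamma> g x (h n) (u n) n s\<^sub>0) \<longlonglongrightarrow> 0) \<and>
    \<comment> \<open>(vii): the integral exists for all large n and satisfies the limit relation\<close>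
    (\<forall>\<^sub>F n in sequentially.
       set_integrable lborel {1..} (\<lambda>t. V_bias M X Y K F \<gamma> g x (h n) (u n) n t / t)) \<and>
    (\<lambda>n. sqrt (real (k n) * h n) *
       (LINT t:{1..}|lborel. V_bias M X Y K F \<gamma> g x (h n) (u n) n t / t)) \<longlonglongrightarrow> 0"
proof -
  interpret prob_space M by fact
  note XY[measurable] = assms(3,4)
  note st = assms(6)[unfolded Z_def] and g0 = assms(7) and dis = assms(8) and K = assms(18)
  note S_eq = assms(17)
  define S where "S = survival (F x)"
  define \<rho> where "\<rho> = 1 / \<gamma> x"
  have \<rho>: "\<rho> > 0" using assms(13,15) by (simp add: \<rho>_def)
  have \<zeta>: "\<zeta>\<^sub>x \<ge> \<rho>" using S'(2) assms(13,15) by (simp add: \<rho>_def field_simps)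
  obtain A where A: "\<And>t. t \<ge> 1 \<Longrightarrow> \<bar>S t - c\<^sub>x * ln t * t powr (-\<rho>)\<bar> \<le> A * t powr (-\<zeta>\<^sub>x)"
  proof -
    obtain A where A: "\<And>t. t \<ge> 1 \<Longrightarrow> t powr \<zeta>\<^sub>x * \<bar>S t - c\<^sub>x * ln t * t powr (- 1 / \<gamma> x)\<bar> \<le> A"
      using S'(3) by (auto simp: bdd_above_def S_def)
    have "\<bar>S t - c\<^sub>x * ln t * t powr (-\<rho>)\<bar> \<le> A * t powr (-\<zeta>\<^sub>x)" if "t \<ge> 1" for t
      using A[OF that] that by (simp add: \<rho>_def powr_minus field_simps)
    thus ?thesis by (rule that)
  qed
  have Lpos: "L u y > 0" if "u \<in> U" "y > 0" for u y
    using assms(16) that by (auto simp: slowly_varying_def)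

  \<comment> \<open>The exponent \<open>e\<close> must be below \<open>\<nu>/2\<close> for the blocks to decouple and below \<open>1/2\<close> for \<open>l\<close> to be negligible against \<open>r\<close>.\<close>
  define e where "e = min (1/4) (\<nu>/4)"
  have e: "0 < e" "e < 1/2" "e < \<nu>/2" using assms(22) by (auto simp: e_def)
  \<comment> \<open>With these choices \<open>k * h\<close> is of order \<open>ln n\<close>: it diverges, but more slowly than the square of \<open>ln (u n)\<close>.\<close>
  define k where "k = (\<lambda>n. nat \<lfloor>real n powr (1/4)\<rfloor>)"
  define l where "l = (\<lambda>n. nat \<lfloor>real n powr (1/2)\<rfloor>)"
  define r where "r = (\<lambda>n. nat \<lfloor>real n powr (1-e)\<rfloor>)"
  define h where "h = (\<lambda>n. ln (real n + 2) / (real n + 1) powr (1/4))"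
  define u where "u = (\<lambda>n. gen_inverse (F x) (1 - real (k n) / real n))"
  \<comment> \<open>An upper bound for \<open>k * h\<close> without the floor function.\<close>
  define q where "q = (\<lambda>n. real n powr (1/4) * h n)"
  have im: "intermediate k" "intermediate l" "intermediate r"
    unfolding k_def l_def r_def using e by (auto intro!: intermediate_floor_powr)
  have kb: "real n powr (1/4) / 2 \<le> real (k n)" "real (k n) \<le> real n powr (1/4)" "1 \<le> real (k n)"
    if "n \<ge> 1" for n unfolding k_def using floor_powr_bounds[of "1/4" n] that by auto
  have lb: "real n powr (1/2) / 2 \<le> real (l n)" "real (l n) \<le> real n powr (1/2)"
    if "n \<ge> 1" for n unfolding l_def using floor_powr_bounds[of "1/2" n] that by auto
  have rb: "real n powr (1-e) / 2 \<le> real (r n)" "real (r n) \<le> real n powr (1-e)" "1 \<le> real (r n)"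
    if "n \<ge> 1" for n unfolding r_def using floor_powr_bounds[of "1-e" n] e that by auto
  have h: "h n > 0" for n unfolding h_def by (intro divide_pos_pos ln_gt_zero) auto
  hence h0: "h n \<ge> 0" for n by (rule less_imp_le)
  have n1: "\<forall>\<^sub>F n in sequentially. n \<ge> (1::nat)" by (rule eventually_ge_at_top)
  have kh_le: "real (k n) * h n \<le> q n" if "n \<ge> 1" for n
    unfolding q_def using kb(2)[OF that] h0[of n] by (intro mult_right_mono)
  have q0: "q n \<ge> 0" for n using h[of n] by (simp add: q_def)

  have lim_qlog: "(\<lambda>n. sqrt (q n) / ln (real n)) \<longlonglongrightarrow> 0" unfolding q_def h_def by real_asymp
  have lim_qhlog: "(\<lambda>n. sqrt (q n) * (h n * ln (real n))) \<longlonglongrightarrow> 0" unfolding q_def h_def by real_asymp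
  have lim_hlog: "(\<lambda>n. h n * ln (real n)) \<longlonglongrightarrow> 0" unfolding h_def by real_asymp
  have lim_h: "h \<longlonglongrightarrow> 0" unfolding h_def by real_asymp
  have lim_q_h2: "(\<lambda>n. q n / (real n * (h n)\<^sup>2)) \<longlonglongrightarrow> 0" unfolding q_def h_def by real_asymp
  have lim_qh2: "(\<lambda>n. q n * (h n)\<^sup>2) \<longlonglongrightarrow> 0" unfolding q_def h_def by real_asymp
  have lim_q: "filterlim (\<lambda>n. real n powr (1/4) / 2 * h n) at_top sequentially" unfolding h_def by real_asymp
  have lim_qe: "(\<lambda>n. real n powr (-e) * q n) \<longlonglongrightarrow> 0" unfolding q_def h_def using e(1) by real_asymp

  obtain N where N: "real_distribution N" "F x = cdf N"
    using conditional_cdf_is_cdf[OF assms(11)] by blast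
  interpret N: real_distribution N by fact
  have Su: "\<forall>\<^sub>F n in sequentially. S (u n) = real (k n) / real n"
  proof -
    have "\<forall>\<^sub>F n in sequentially. real (k n) / real n < 1"
      using im(1) unfolding intermediate_def by (intro order_tendstoD) auto
    thus ?thesis using n1
    proof eventually_elim
      case (elim n)
      thus ?case using survival_gen_inverse[OF N(1), of "real (k n) / real n"] assms(24) kb(3)[OF elim(2)]
        by (simp add: S_def u_def N(2))
    qed
  qed
  have u_inf: "filterlim u at_top sequentially"
    unfolding filterlim_at_top
  proof
    fix z :: real
    define y where "y = max z 1"
    have "S y > 0" using S_eq[OF assms(13), of y] Lpos[OF assms(13), of y] by (simp add: S_def y_def)
    hence "\<forall>\<^sub>F n in sequentially. real (k n) / real n < S y"
      using im(1) unfolding intermediate_def by (intro order_tendstoD) auto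
    thus "\<forall>\<^sub>F n in sequentially. z \<le> u n" using Su
    proof eventually_elim
      case (elim n)
      hence "F x y < F x (u n)" by (simp add: S_def survival_def)
      hence "y \<le> u n" using N.cdf_nondecreasing[of "u n" y] by (cases "y \<le> u n") (auto simp: N(2))
      thus ?case by (simp add: y_def)
    qed
  qed
  have growth: "\<forall>\<^sub>F n in sequentially. ln (real n) / (2 * \<rho>) \<le> ln (u n) \<and> ln (u n) \<le> 4 / \<rho> * ln (real n)"
  proof (rule quantile_log_growth[OF S'(1) \<zeta> \<rho> A u_inf Su])
    show "\<forall>\<^sub>F n in sequentially. 1 / real n \<le> real (k n) / real n"
      using n1 by eventually_elim (intro divide_right_mono kb(3), auto)
    show "\<forall>\<^sub>F n in sequentially. real (k n) / real n \<le> real n powr (-3/4)"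
      using n1
    proof eventually_elim
      case (elim n)
      have "real (k n) / real n \<le> real n powr (1/4) / real n powr 1"
        using kb(2)[OF elim] by (simp add: divide_right_mono)
      also have "\<dots> = real n powr (1/4 - 1)" by (simp only: powr_diff)
      finally show ?case by simp
    qed
  qed

  \<comment> \<open>Up to a constant, \<open>w\<close> dominates the bias at every level \<open>t \<ge> 1/2\<close>.\<close>
  define w where "w = (\<lambda>n. 1 / ln (u n) + h n * ln (u n))"
  have lnn: "\<forall>\<^sub>F n in sequentially. ln (real n) > 0" by real_asymp
  have hlu: "\<forall>\<^sub>F n in sequentially. 0 \<le> h n * ln (u n) \<and> h n * ln (u n) \<le> 4 / \<rho> * (h n * ln (real n))"
    using growth lnn
  proof eventually_elim
    case (elim n)
    have "0 < ln (real n) / (2 * \<rho>)" using elim(2) \<rho> by simp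
    hence "0 \<le> ln (u n)" using elim by linarith
    thus ?case using elim h[of n] mult_left_mono[of "ln (u n)" "4 / \<rho> * ln (real n)" "h n"] by (simp add: mult_ac)
  qed
  have i: "(\<lambda>n. h n * ln (u n)) \<longlonglongrightarrow> 0"
    by (rule tendsto_sandwich[OF _ _ tendsto_const tendsto_mult_right_zero[OF lim_hlog, of "4/\<rho>"]])
       (use hlu in \<open>auto elim: eventually_mono\<close>)
  have w0: "\<forall>\<^sub>F n in sequentially. 0 \<le> w n \<and> w n \<le> 2 * \<rho> / ln (real n) + 4 / \<rho> * (h n * ln (real n))"
    using growth lnn hlu
  proof eventually_elim
    case (elim n)
    have pos: "0 < ln (real n) / (2 * \<rho>)" using elim \<rho> by simp
    hence "1 / ln (u n) \<le> 1 / (ln (real n) / (2 * \<rho>))" using elim pos by (intro frac_le) auto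
    moreover have "0 \<le> 1 / ln (u n)" using elim pos by simp
    ultimately show ?case using elim unfolding w_def by simp
  qed
  have sw: "(\<lambda>n. sqrt (real (k n) * h n) * (C * w n)) \<longlonglongrightarrow> 0" for C
  proof -
    have "(\<lambda>n. sqrt (real (k n) * h n) * w n) \<longlonglongrightarrow> 0"
    proof (rule tendsto_sandwich[OF _ _ tendsto_const])
      show "(\<lambda>n. 2 * \<rho> * (sqrt (q n) / ln (real n)) + 4 / \<rho> * (sqrt (q n) * (h n * ln (real n)))) \<longlonglongrightarrow> 0"
        by (intro tendsto_add_zero tendsto_mult_right_zero lim_qlog lim_qhlog)
      show "\<forall>\<^sub>F n in sequentially. 0 \<le> sqrt (real (k n) * h n) * w n"
        using w0 by eventually_elim (use h in \<open>simp add: less_imp_le\<close>)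
      show "\<forall>\<^sub>F n in sequentially. sqrt (real (k n) * h n) * w n
          \<le> 2 * \<rho> * (sqrt (q n) / ln (real n)) + 4 / \<rho> * (sqrt (q n) * (h n * ln (real n)))"
        using w0 n1
      proof eventually_elim
        case (elim n)
        have "sqrt (real (k n) * h n) * w n \<le> sqrt (q n) * (2 * \<rho> / ln (real n) + 4 / \<rho> * (h n * ln (real n)))"
          using elim kh_le[of n] q0[of n] by (intro mult_mono) auto
        also have "\<dots> = 2 * \<rho> * (sqrt (q n) / ln (real n)) + 4 / \<rho> * (sqrt (q n) * (h n * ln (real n)))"
          by (simp add: algebra_simps)
        finally show ?case .
      qed
    qed
    from tendsto_mult_right_zero[OF this, of C] show ?thesis by (simp add: mult_ac)
  qed

  obtain g' where g': "(g has_real_derivative g') (at x)"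
    using assms(9) unfolding twice_cont_diff_def by blast
  have gm[measurable]: "g \<in> borel_measurable borel"
    using distributed_real_measurable[OF _ dis] g0 by simp
  define b where "b = (\<lambda>n t. V_bias M X Y K F \<gamma> g x (h n) (u n) n t)"
  have bm: "b n \<in> borel_measurable borel" for n unfolding b_def
    by (rule V_bias_measurable) (use XY K assms(2) in \<open>auto simp: kernel_density_def\<close>)
  obtain C where C: "C \<ge> 0" and bias: "\<forall>\<^sub>F n in sequentially. \<forall>t\<ge>1/2. \<bar>b n t\<bar> \<le> C * w n * t powr (-(\<rho>/2))"
  proof -
    have "\<exists>C \<epsilon> u0. C \<ge> 0 \<and> \<epsilon> > 0 \<and> (\<forall>h u v t. 0 < h \<longrightarrow> h \<le> \<epsilon> \<longrightarrow> h * ln u \<le> \<epsilon> \<longrightarrow> u \<ge> u0 \<longrightarrow> \<bar>v - x\<bar> \<le> h \<longrightarrow> t \<ge> 1/2 \<longrightarrow>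
       \<bar>survival (F v) (t * u) / survival (F x) u * g v - t powr (- 1 / \<gamma> x) * g x\<bar>
       \<le> C * (1 / ln u + h * ln u) * t powr (- (1 / \<gamma> x / 2)))"
      by (rule bias_rate[where U = U and L = L and c = "c\<^sub>x" and \<zeta> = "\<zeta>\<^sub>x" and A = A, OF g' _ assms(12,13) _ Lpos S_eq C1 C3 S'(1)])
         (use assms(13,14,15) \<zeta> A in \<open>auto simp: S_def \<rho>_def\<close>)
    then obtain C \<epsilon> u0 where C: "C \<ge> 0" "\<epsilon> > 0" and bd: "\<And>h u v t. 0 < h \<Longrightarrow> h \<le> \<epsilon> \<Longrightarrow> h * ln u \<le> \<epsilon> \<Longrightarrow> u \<ge> u0 \<Longrightarrow> \<bar>v - x\<bar> \<le> h \<Longrightarrow> t \<ge> 1/2 \<Longrightarrow>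
       \<bar>survival (F v) (t * u) / survival (F x) u * g v - t powr (- 1 / \<gamma> x) * g x\<bar>
       \<le> C * (1 / ln u + h * ln u) * t powr (- (1 / \<gamma> x / 2))" by metis
    have "\<forall>\<^sub>F n in sequentially. h n < \<epsilon>" "\<forall>\<^sub>F n in sequentially. h n * ln (u n) < \<epsilon>"
      using lim_h i C(2) by (auto intro: order_tendstoD)
    moreover have "\<forall>\<^sub>F n in sequentially. u n \<ge> u0" using u_inf unfolding filterlim_at_top by blast
    ultimately have "\<forall>\<^sub>F n in sequentially. \<forall>t\<ge>1/2. \<bar>b n t\<bar> \<le> C * w n * t powr (-(\<rho>/2))"
      using n1
    proof eventually_elim
      case (elim n)
      show ?case
      proof (intro allI impI)
        fix t :: real assume t: "t \<ge> 1/2"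
        have "(\<lambda>v. survival (F v) (t * u n)) \<in> borel_measurable borel"
          by (rule conditional_tail_expectation(1)[OF assms(2) XY(1) XY(2) dis g0 assms(11), of "\<lambda>_. 0"]) auto
        hence meas: "(\<lambda>v. survival (F v) (t * u n) / survival (F x) (u n) * g v) \<in> borel_measurable borel"
          by (intro borel_measurable_times borel_measurable_divide gm) auto
        show "\<bar>b n t\<bar> \<le> C * w n * t powr (-(\<rho>/2))"
          unfolding b_def V_bias_def V_tilde_mean[OF assms(2) XY st g0 dis assms(11) K elim(4)]
          by (rule kernel_average_error[OF K h meas]) (use bd[OF h _ _ elim(3) _ t] elim in \<open>auto simp: w_def \<rho>_def\<close>)
      qed
    qed
    thus ?thesis using C(1) that by blast
  qed

  have ii: "\<forall>\<^sub>F n in sequentially. real n * h n * survival (F x) (u n) = real (k n) * h n"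
    using Su n1 by eventually_elim (simp add: S_def)
  have kh_inf: "filterlim (\<lambda>n. real (k n) * h n) at_top sequentially"
  proof (rule filterlim_at_top_mono[OF lim_q])
    show "\<forall>\<^sub>F n in sequentially. real n powr (1/4) / 2 * h n \<le> real (k n) * h n"
      using n1 by eventually_elim (intro mult_right_mono kb(1) h0)
  qed
  have iii: "\<forall>\<^sub>F n in sequentially.
       real (r n) * h n * survival (F x) (u n) = real (r n) * h n * real (k n) / real n"
    using Su by eventually_elim (simp add: S_def)
  have iii': "(\<lambda>n. real (r n) * h n * real (k n) / real n) \<longlonglongrightarrow> 0"
  proof (rule tendsto_sandwich[OF _ _ tendsto_const lim_qe])
    show "\<forall>\<^sub>F n in sequentially. 0 \<le> real (r n) * h n * real (k n) / real n"
      using h0 by (auto intro!: always_eventually mult_nonneg_nonneg divide_nonneg_nonneg)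
    show "\<forall>\<^sub>F n in sequentially. real (r n) * h n * real (k n) / real n \<le> real n powr (-e) * q n"
      using n1
    proof eventually_elim
      case (elim n)
      have "real (r n) / real n \<le> real n powr (1-e) / real n powr 1"
        using rb(2)[OF elim] elim by (simp add: divide_right_mono)
      also have "\<dots> = real n powr (1 - e - 1)" by (simp only: powr_diff)
      also have "1 - e - 1 = -e" by simp
      finally have "real (r n) / real n * (real (k n) * h n) \<le> real n powr (-e) * q n"
        using kh_le[OF elim] h[of n] by (intro mult_mono) auto
      thus ?case by (simp add: mult_ac)
    qed
  qed
  have l_inf: "filterlim l at_top sequentially" using im(2) by (simp add: intermediate_def)
  have iv1: "(\<lambda>n. 1 / real (l n)) \<longlonglongrightarrow> 0"
    by (intro tendsto_divide_0[OF tendsto_const] filterlim_at_top_imp_at_infinity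
          filterlim_compose[OF filterlim_real_sequentially l_inf])
  have iv2: "(\<lambda>n. real (l n) / real (r n)) \<longlonglongrightarrow> 0"
  proof (rule tendsto_sandwich[OF _ _ tendsto_const])
    show "(\<lambda>n. 2 * real n powr (-(1/2 - e))) \<longlonglongrightarrow> 0" using e by real_asymp
    show "\<forall>\<^sub>F n in sequentially. real (l n) / real (r n) \<le> 2 * real n powr (-(1/2 - e))"
      using n1
    proof eventually_elim
      case (elim n)
      have "real (l n) / real (r n) \<le> real n powr (1/2) / (real n powr (1-e) / 2)"
        using lb(2)[OF elim] rb(1)[OF elim] elim by (intro frac_le) auto
      also have "\<dots> = 2 * real n powr (1/2 - (1 - e))" by (simp only: powr_diff) simp
      finally show ?case by simp
    qed
  qed auto
  have iv3: "(\<lambda>n. real (r n) / real n) \<longlonglongrightarrow> 0" using im(3) by (simp add: intermediate_def)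
  have iv4: "(\<lambda>n. real n / real (r n) * beta_coeff M Z (l n)) \<longlonglongrightarrow> 0"
  proof -
    obtain Cb where Cb: "Cb > 0" "\<forall>\<^sub>F j in sequentially. norm (beta_coeff M Z j) \<le> Cb * norm (real j powr (-\<nu>))"
      using landau_o.bigE[OF assms(23)] by blast
    have "\<forall>\<^sub>F n in sequentially. norm (beta_coeff M Z (l n)) \<le> Cb * norm (real (l n) powr (-\<nu>))"
      using eventually_compose_filterlim[OF Cb(2) l_inf] .
    hence "\<forall>\<^sub>F n in sequentially. norm (real n / real (r n) * beta_coeff M Z (l n)) \<le> 2 * Cb * 2 powr \<nu> * real n powr (-(\<nu>/2 - e))"
      using n1
    proof eventually_elim
      case (elim n)
      have n: "real n > 0" using elim by simp
      have "real (l n) powr (-\<nu>) \<le> (real n powr (1/2) / 2) powr (-\<nu>)"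
        using lb(1)[OF elim(2)] n assms(22) by (intro powr_mono2') auto
      also have "\<dots> = 2 powr \<nu> * real n powr (-(\<nu>/2))"
        using n by (simp add: powr_divide powr_powr powr_minus field_simps)
      finally have "Cb * norm (real (l n) powr (-\<nu>)) \<le> Cb * (2 powr \<nu> * real n powr (-(\<nu>/2)))"
        using Cb(1) by (intro mult_left_mono) auto
      hence b: "\<bar>beta_coeff M Z (l n)\<bar> \<le> Cb * (2 powr \<nu> * real n powr (-(\<nu>/2)))" using elim(1) by simp
      have "real n / real (r n) \<le> real n powr 1 / (real n powr (1-e) / 2)"
        using rb(1)[OF elim(2)] n by (intro frac_le) auto
      also have "\<dots> = 2 * real n powr (1 - (1 - e))" using n by (simp only: powr_diff) simp
      finally have "real n / real (r n) \<le> 2 * real n powr e" by simp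
      hence "real n / real (r n) * \<bar>beta_coeff M Z (l n)\<bar> \<le> (2 * real n powr e) * (Cb * (2 powr \<nu> * real n powr (-(\<nu>/2))))"
        using b by (intro mult_mono) auto
      also have "\<dots> = 2 * Cb * 2 powr \<nu> * (real n powr e * real n powr (-(\<nu>/2)))" by simp
      also have "real n powr e * real n powr (-(\<nu>/2)) = real n powr (-(\<nu>/2 - e))"
        by (simp flip: powr_add)
      finally show ?case by (simp add: abs_mult)
    qed
    moreover have "(\<lambda>n. 2 * Cb * 2 powr \<nu> * real n powr (-(\<nu>/2 - e))) \<longlonglongrightarrow> 0"
      using e(3) by (intro tendsto_mult_right_zero tendsto_neg_powr filterlim_real_sequentially) auto
    ultimately show ?thesis by (rule Lim_null_comparison)
  qed

  have v: "tendsto_in_prob M (\<lambda>n \<omega>. sqrt (real (k n) * h n) * (g x - dens_est X K x (h n) n \<omega>)) 0"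
  proof -
    have sm: "summable (alpha_coeff M Z)"
    proof (rule summable_comparison_test_bigo[OF _ assms(21)])
      show "summable (\<lambda>n. norm (real n powr (-\<eta>)))" using assms(20) by (simp add: summable_real_powr_iff)
    qed
    obtain G d where G: "d > 0" "\<And>v. \<bar>v - x\<bar> < d \<Longrightarrow> \<bar>g v - g x\<bar> \<le> G * \<bar>v - x\<bar>" "G \<ge> 0"
      using derivative_imp_Lipschitz_at[OF g'] by blast
    have "bounded (range K)" using K by (simp add: kernel_density_def)
    then obtain B where "\<forall>z\<in>range K. norm z \<le> B" unfolding bounded_iff by blast
    hence B: "K t \<le> B" for t using abs_le_D1[of "K t" B] by simp
    define a where "a = 4 * B\<^sup>2 * (\<Sum>j. alpha_coeff M Z j)"
    have "\<forall>\<^sub>F n in sequentially. h n < d" using lim_h G(1) by (rule order_tendstoD)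
    hence "\<forall>\<^sub>F n in sequentially. integrable M (\<lambda>\<omega>. (sqrt (real (k n) * h n) * (g x - dens_est X K x (h n) n \<omega>))\<^sup>2)
       \<and> (\<integral>\<omega>. (sqrt (real (k n) * h n) * (g x - dens_est X K x (h n) n \<omega>))\<^sup>2 \<partial>M)
           \<le> a * (q n / (real n * (h n)\<^sup>2)) + 2 * G\<^sup>2 * (q n * (h n)\<^sup>2)"
      using n1
    proof eventually_elim
      case (elim n)
      have loc: "\<bar>g v - g x\<bar> \<le> G * h n" if "\<bar>v - x\<bar> \<le> h n" for v
        using G(2)[of v] mult_left_mono[OF that G(3)] that elim(1) by linarith
      note m = dens_est_mse[OF assms(2) XY st g0 dis K B h elim(2) sm[unfolded Z_def] loc, folded Z_def, folded a_def]
      let ?E = "\<integral>\<omega>. (g x - dens_est X K x (h n) n \<omega>)\<^sup>2 \<partial>M"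
      have sq: "(sqrt (real (k n) * h n))\<^sup>2 = real (k n) * h n" using h[of n] by simp
      have "real (k n) * h n * ?E \<le> q n * (a / (real n * (h n)\<^sup>2) + 2 * (G * h n)\<^sup>2)"
        using kh_le[OF elim(2)] m(2) q0[of n] by (intro mult_mono) auto
      also have "\<dots> = a * (q n / (real n * (h n)\<^sup>2)) + 2 * G\<^sup>2 * (q n * (h n)\<^sup>2)"
        by (simp add: algebra_simps power_mult_distrib)
      finally show ?case using m(1) by (simp add: power_mult_distrib sq)
    qed
    moreover have "(\<lambda>n. a * (q n / (real n * (h n)\<^sup>2)) + 2 * G\<^sup>2 * (q n * (h n)\<^sup>2)) \<longlonglongrightarrow> 0"
      by (intro tendsto_add_zero tendsto_mult_right_zero lim_q_h2 lim_qh2)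
    ultimately show ?thesis by (rule second_moment_imp_tendsto_in_prob[OF assms(2)])
  qed

  have vi: "(\<lambda>n. sqrt (real (k n) * h n) * B_sup M X Y K F \<gamma> g x (h n) (u n) n (1/2)) \<longlonglongrightarrow> 0"
  proof (rule tendsto_sandwich[OF _ _ tendsto_const sw[of "C * 2 powr (\<rho>/2)"]])
    have *: "\<forall>\<^sub>F n in sequentially. 0 \<le> B_sup M X Y K F \<gamma> g x (h n) (u n) n (1/2) \<and>
       B_sup M X Y K F \<gamma> g x (h n) (u n) n (1/2) \<le> C * 2 powr (\<rho>/2) * w n"
      using bias w0
    proof eventually_elim
      case (elim n)
      have bd: "\<bar>b n t\<bar> \<le> C * 2 powr (\<rho>/2) * w n" if "t \<ge> 1/2" for t
      proof -
        have "t powr (-(\<rho>/2)) \<le> (1/2) powr (-(\<rho>/2))" using that \<rho> by (intro powr_mono2') auto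
        also have "\<dots> = 2 powr (\<rho>/2)" by (simp add: powr_divide powr_minus field_simps)
        finally have "C * w n * t powr (-(\<rho>/2)) \<le> C * w n * 2 powr (\<rho>/2)"
          using C elim by (intro mult_left_mono) auto
        thus ?thesis using elim(1) that by (force simp: mult_ac)
      qed
      have "\<bar>b n (1/2)\<bar> \<le> (SUP t\<in>{1/2..}. \<bar>b n t\<bar>)"
        by (rule cSUP_upper) (use bd in \<open>auto intro!: bdd_aboveI2\<close>)
      moreover have "(SUP t\<in>{1/2..}. \<bar>b n t\<bar>) \<le> C * 2 powr (\<rho>/2) * w n"
        by (rule cSUP_least) (use bd in auto)
      ultimately show ?case by (simp add: B_sup_def b_def)
    qed
    show "\<forall>\<^sub>F n in sequentially. 0 \<le> sqrt (real (k n) * h n) * B_sup M X Y K F \<gamma> g x (h n) (u n) n (1/2)"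
      using * by eventually_elim (use h0 in \<open>auto intro!: mult_nonneg_nonneg\<close>)
    show "\<forall>\<^sub>F n in sequentially. sqrt (real (k n) * h n) * B_sup M X Y K F \<gamma> g x (h n) (u n) n (1/2)
       \<le> sqrt (real (k n) * h n) * (C * 2 powr (\<rho>/2) * w n)"
      using * by eventually_elim (use h0 in \<open>auto intro!: mult_left_mono mult_nonneg_nonneg\<close>)
  qed

  have vii: "\<forall>\<^sub>F n in sequentially. set_integrable lborel {1..} (\<lambda>t. b n t / t) \<and>
      \<bar>LINT t:{1..}|lborel. b n t / t\<bar> \<le> C * w n / (\<rho>/2)"
    using bias
  proof eventually_elim
    case (elim n)
    have "\<bar>b n t\<bar> \<le> C * w n * t powr (-(\<rho>/2))" if "t \<ge> 1" for t using elim that by simp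
    from log_scale_integral_bound[OF _ bm this] show ?case using \<rho> by simp
  qed
  have vii': "(\<lambda>n. sqrt (real (k n) * h n) * (LINT t:{1..}|lborel. b n t / t)) \<longlonglongrightarrow> 0"
  proof (rule Lim_null_comparison[OF _ sw[of "C / (\<rho>/2)"]])
    show "\<forall>\<^sub>F n in sequentially. norm (sqrt (real (k n) * h n) * (LINT t:{1..}|lborel. b n t / t))
        \<le> sqrt (real (k n) * h n) * (C / (\<rho>/2) * w n)"
      using vii
    proof eventually_elim
      case (elim n)
      have "sqrt (real (k n) * h n) * \<bar>LINT t:{1..}|lborel. b n t / t\<bar> \<le> sqrt (real (k n) * h n) * (C * w n / (\<rho>/2))"
        using elim h[of n] by (intro mult_left_mono) auto
      thus ?case using h[of n] by (simp add: abs_mult mult_ac)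
    qed
  qed

  show ?thesis
  proof (rule exI[of _ k], rule exI[of _ h], rule exI[of _ r], rule exI[of _ l], rule exI[of _ u], intro conjI)
    show "\<exists>s\<^sub>0. 0 < s\<^sub>0 \<and> s\<^sub>0 < 1 \<and>
       (\<lambda>n. sqrt (real (k n) * h n) * B_sup M X Y K F \<gamma> g x (h n) (u n) n s\<^sub>0) \<longlonglongrightarrow> 0"
      using vi by (intro exI[of _ "1/2"]) auto
    show "\<forall>\<^sub>F n in sequentially. set_integrable lborel {1..} (\<lambda>t. V_bias M X Y K F \<gamma> g x (h n) (u n) n t / t)"
      using vii by eventually_elim (simp add: b_def)
    show "(\<lambda>n. sqrt (real (k n) * h n) *
       (LINT t:{1..}|lborel. V_bias M X Y K F \<gamma> g x (h n) (u n) n t / t)) \<longlonglongrightarrow> 0"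
      using vii' by (simp add: b_def)
    show "\<forall>n. u n = gen_inverse (F x) (1 - real (k n) / real n)" by (simp add: u_def)
    show "\<forall>n. h n > 0" using h by simp
  qed (fact im i ii kh_inf iii iii' iv1 iv2 iv3 iv4 v)+
qed

end
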